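(* Let $p(\cdot)$ be a symmetric transition rate. Assume that $p(1)>0$ and that $p(\cdot)\in\mathrm{DAN}(\alpha)$ for some $\alpha\in(0,2)$. Let $\lambda^{\mathrm{ex}}_{n,\ell}$ be the spectral gap of the exclusion process with transition rate $p(\cdot)$ in $\Omega^{\mathrm{ex}}_{n,\ell}$. Then there exist constants $\kappa^{\mathrm{ex}}_1,\kappa^{\mathrm{ex}}_2\in(0,\infty)$ such that \[ \kappa^{\mathrm{ex}}_1(2n+1)^{-\alpha}\le\lambda^{\mathrm{ex}}_{n,\ell}\le\kappa^{\mathrm{ex}}_2(2n+1)^{-\alpha} \] for any $n\in\mathbb{N}$ and any $\ell\in\{0,1,\dots,2n+1\}$.
   Context: $\mathbb{N}=\{1,2,\dots\}$. A transition rate is a non-zero function $p:\mathbb{Z}\to[0,\infty)$ with $p(0)=0$ and $\sum_{z\in\mathbb{Z}}p(z)<\infty$; it is symmetric if $p(z)=p(-z)$ for all $z\in\mathbb{Z}$. A symmetric transition rate $p$ is in $\mathrm{DAN}(\alpha)$ (domain of normal attraction of an $\alpha$-stable law), $\alpha\in(0,2)$, if there is a constant $c\in(0,\infty)$ with $\lim_{x\to\infty}x^\alpha\sum_{y\ge x}p(y)=c$. Let $\Lambda_n=\{-n,\dots,n\}$, $\Omega^{\mathrm{ex}}_n=\{0,1\}^{\Lambda_n}$ and, for $\ell\in\{0,1,\dots,2n+1\}$, $\Omega^{\mathrm{ex}}_{n,\ell}=\{\eta\in\Omega^{\mathrm{ex}}_n:\sum_{x\in\Lambda_n}\eta_x=\ell\}$.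 For $\eta\in\Omega^{\mathrm{ex}}_n$ and $x,y\in\Lambda_n$, let $\eta^{x,y}$ be the configuration obtained from $\eta$ by exchanging the values $\eta_x$ and $\eta_y$. The exclusion process with transition rate $p$ is the continuous-time Markov chain on $\Omega^{\mathrm{ex}}_n$ with generator \[ L^{\mathrm{ex}}_nf(\eta)=\sum_{x,y\in\Lambda_n}p(y-x)\,\eta_x(1-\eta_y)\big(f(\eta^{x,y})-f(\eta)\big). \] It conserves $\sum_x\eta_x$; when $p$ is symmetric and $p(1)>0$, its restriction to each $\Omega^{\mathrm{ex}}_{n,\ell}$ is irreducible and reversible with respect to the uniform measure on $\Omega^{\mathrm{ex}}_{n,\ell}$. For an irreducible continuous-time Markov chain on a finite set with generator $L$, reversible with respect to its equilibrium probability measure $\mu$, the spectral gap is the smallest non-zero eigenvalue of $-L$, given by the variational formula $\inf\{\int f(-Lf)\,d\mu:\int f^2\,d\mu=1,\ \int f\,d\mu=0\}$.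
   Formalization: The upper bound is claimed only for 1 ≤ ℓ ≤ 2n: for ℓ = 0 and ℓ = 2n+1 the state space is a single point, there is no non-zero eigenvalue, and the gap is taken as +∞ (infimum of the empty set); the lower bound is stated for every ℓ. *)

theory Defs
  imports "HOL-Analysis.Analysis"
begin

definition transition_rate :: "(int \<Rightarrow> real) \<Rightarrow> bool" where
  "transition_rate p \<longleftrightarrow>
     (\<forall>z. 0 \<le> p z) \<and> (\<exists>z. p z \<noteq> 0) \<and> p 0 = 0 \<and> p summable_on UNIV"

definition symmetric_rate :: "(int \<Rightarrow> real) \<Rightarrow> bool" where
  "symmetric_rate p \<longleftrightarrow> (\<forall>z. p z = p (- z))"

definition DAN :: "real \<Rightarrow> (int \<Rightarrow> real) set" where
  "DAN \<alpha> = {p. transition_rate p \<and> symmetric_rate p \<and>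
     (\<exists>c>0. ((\<lambda>x::real. x powr \<alpha> * (\<Sum>\<^sub>\<infinity>y\<in>{y. x \<le> real_of_int y}. p y)) \<longlongrightarrow> c) at_top)}"

definition box :: "nat \<Rightarrow> int set" where
  "box n = {- int n .. int n}"

definition \<Omega>_ex :: "nat \<Rightarrow> (int \<Rightarrow> nat) set" where
  "\<Omega>_ex n = box n \<rightarrow>\<^sub>E {0, 1}"

definition \<Omega>_ex_level :: "nat \<Rightarrow> nat \<Rightarrow> (int \<Rightarrow> nat) set" where
  "\<Omega>_ex_level n l = {\<eta> \<in> \<Omega>_ex n. (\<Sum>x\<in>box n. \<eta> x) = l}"

definition exchange :: "(int \<Rightarrow> nat) \<Rightarrow> int \<Rightarrow> int \<Rightarrow> (int \<Rightarrow> nat)" where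
  "exchange \<eta> x y = \<eta>(x := \<eta> y, y := \<eta> x)"

definition L_ex ::
    "(int \<Rightarrow> real) \<Rightarrow> nat \<Rightarrow> ((int \<Rightarrow> nat) \<Rightarrow> real) \<Rightarrow> ((int \<Rightarrow> nat) \<Rightarrow> real)" where
  "L_ex p n f \<eta> = (\<Sum>x\<in>box n. \<Sum>y\<in>box n.
     p (y - x) * real (\<eta> x) * (1 - real (\<eta> y)) * (f (exchange \<eta> x y) - f \<eta>))"

text \<open>
  In the next two definitions \<open>S\<close> is a finite set closed under the jumps of the chain with
  generator \<open>L\<close>, so the values of \<open>f\<close> outside \<open>S\<close> do not influence \<open>L f\<close> on \<open>S\<close>, and the
  condition below speaks about the generator of the chain restricted to \<open>S\<close>.
  Reversible generators have only real eigenvalues.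
\<close>

definition eigenvalue_on :: "'s set \<Rightarrow> (('s \<Rightarrow> real) \<Rightarrow> ('s \<Rightarrow> real)) \<Rightarrow> real \<Rightarrow> bool" where
  "eigenvalue_on S A \<theta> \<longleftrightarrow> (\<exists>f. (\<exists>s\<in>S. f s \<noteq> 0) \<and> (\<forall>s\<in>S. A f s = \<theta> * f s))"

text \<open>
  On a finite \<open>S\<close> there are finitely many eigenvalues, so the infimum is the smallest non-zero
  eigenvalue of \<open>-L\<close> whenever there is one.  If \<open>S\<close> is a singleton, there is none and the gap
  is \<open>\<infinity>\<close>, in agreement with the variational formula (infimum of the empty set).
\<close>

definition spectral_gap :: "'s set \<Rightarrow> (('s \<Rightarrow> real) \<Rightarrow> ('s \<Rightarrow> real)) \<Rightarrow> ereal" where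
  "spectral_gap S L = (INF \<theta>\<in>{\<theta>. \<theta> \<noteq> 0 \<and> eigenvalue_on S (\<lambda>f s. - L f s) \<theta>}. ereal \<theta>)"

definition gap_ex :: "(int \<Rightarrow> real) \<Rightarrow> nat \<Rightarrow> nat \<Rightarrow> ereal" where
  "gap_ex p n l = spectral_gap (\<Omega>_ex_level n l) (L_ex p n)"

end

(*
  Lower bound.  For f of mean zero on a level, the transposition walk on all N = 2n+1 sites has
  gap of order N, so |f|^2 is at most (1/N) times the sum over all pairs of the swap energies
  E|f(eta^{x,y}) - f|^2.  Let E_t be the total swap energy of the pairs at distance t.  Writing a
  long swap as a conjugated product of shorter ones gives sqrt(E_{s+t}) <= 2 sqrt(E_s) + sqrt(E_t),
  hence E_t <= 2 E_{t mod d} + 8 (t/d)^2 E_d for every d.  Averaging over t <= m and over the jump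
  d in [s,2s) with weight p(d), whose mass is of order s^(-alpha), bounds S_m = sum_{t<=m} E_t by
  8 (m/2s) S_{2s} plus a multiple of (m/s)^2 m s^alpha times the Dirichlet form.  Since the constant 8 does
  not depend on m/s, taking m/s = R with 8 (2/R)^alpha <= 1/2 makes the recursion contract.

  Upper bound.  Linear statistics sum_x a_x eta_x are mapped to linear statistics, so every
  nonzero eigenvalue of the random walk with rates p on the box is an eigenvalue of the exclusion
  process; the walk is tested with a_x = x.
*)

theory Submission imports Defs begin

section \<open>Levels of the cube\<close>

text \<open>Membership in \<open>DAN \<alpha>\<close> controls the tails of \<open>p\<close> but no
  single rate: \<open>p d\<close> may vanish for most d. Hence no comparison distance by distance is
  possible, and one has to average over a block of jumps. Comparing everything with
  nearest-neighbour swaps through p(1) > 0 would only give a gap of order N^(-2); that comparison is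
  kept for the bounded scales, where the tail asymptotics say nothing. The remainders t mod d are
  shorter than the jumps of the block and have to be fed back, which makes the argument recursive.

  Since \<open>spectral_gap\<close> is an infimum over eigenvalues, the lower bound tests each
  eigenfunction and needs no spectral theorem on the level. The upper bound needs a genuine
  eigenfunction; looking for it among the linear statistics reduces this to a minimisation over
  functions on N sites.

  The bounds are uniform in the number of particles because neither the Poincare constant of the
  complete graph nor the one-particle eigenvalue depends on it.\<close>

definition level :: "'a set \<Rightarrow> nat \<Rightarrow> ('a \<Rightarrow> nat) set" where
  "level V k = {\<eta> \<in> V \<rightarrow>\<^sub>E {0, 1}. sum \<eta> V = k}"

text \<open>These are the spin operators of the sl(2) action on functions on the cube, named for
  what they do to the level of a function: \<open>lowering\<close> sends functions on level k+1 to
  functions on level k, although its body adds a particle.\<close>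

definition lowering :: "'a set \<Rightarrow> (('a \<Rightarrow> nat) \<Rightarrow> real) \<Rightarrow> ('a \<Rightarrow> nat) \<Rightarrow> real" where
  "lowering V f \<xi> = (\<Sum>b | b \<in> V \<and> \<xi> b = 0. f (\<xi>(b := 1)))"

definition raising :: "'a set \<Rightarrow> (('a \<Rightarrow> nat) \<Rightarrow> real) \<Rightarrow> ('a \<Rightarrow> nat) \<Rightarrow> real" where
  "raising V g \<eta> = (\<Sum>a | a \<in> V \<and> \<eta> a = 1. g (\<eta>(a := 0)))"

lemma finite_level: "finite V \<Longrightarrow> finite (level V k)"
  unfolding level_def by (rule finite_subset[OF _ finite_PiE[of V "\<lambda>_. {0,1}"]]) auto

lemma level_values: "\<eta> \<in> level V k \<Longrightarrow> x \<in> V \<Longrightarrow> \<eta> x = 0 \<or> \<eta> x = 1"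
  unfolding level_def by (auto dest: PiE_mem)

lemma card_ones:
  assumes "finite V" "\<eta> \<in> level V k"
  shows "card {a \<in> V. \<eta> a = 1} = k"
proof -
  have "k = sum \<eta> V" using assms by (simp add: level_def)
  also have "\<dots> = (\<Sum>x\<in>V. if \<eta> x = 1 then 1 else 0)"
    using level_values[OF assms(2)] by (intro sum.cong) auto
  also have "\<dots> = card {a \<in> V. \<eta> a = 1}"
    using assms(1) by (simp add: sum.If_cases Int_def)
  finally show ?thesis ..
qed

lemma card_zeros:
  assumes "finite V" "\<eta> \<in> level V k"
  shows "card {a \<in> V. \<eta> a = 0} + k = card V"
proof -
  have "V = {a \<in> V. \<eta> a = 0} \<union> {a \<in> V. \<eta> a = 1}"
    using level_values[OF assms(2)] by auto
  then have "card V = card {a \<in> V. \<eta> a = 0} + card {a \<in> V. \<eta> a = 1}"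
    using assms(1) card_Un_disjoint[of "{a \<in> V. \<eta> a = 0}" "{a \<in> V. \<eta> a = 1}"] by fastforce
  then show ?thesis using card_ones[OF assms] by simp
qed

lemma level_insert:
  assumes "finite V" "\<xi> \<in> level V k" "b \<in> V" "\<xi> b = 0"
  shows "\<xi>(b := 1) \<in> level V (Suc k)"
proof -
  have "sum (\<xi>(b := 1)) V = Suc (sum \<xi> (V - {b}))"
    using assms by (simp add: sum.remove[of V b])
  moreover have "sum \<xi> V = sum \<xi> (V - {b})"
    using assms by (simp add: sum.remove[of V b])
  ultimately show ?thesis using assms
    by (auto simp: level_def PiE_def Pi_def extensional_def)
qed

lemma level_remove:
  assumes "finite V" "\<eta> \<in> level V (Suc k)" "b \<in> V" "\<eta> b = 1"
  shows "\<eta>(b := 0) \<in> level V k"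
proof -
  have "sum (\<eta>(b := 0)) V = sum \<eta> (V - {b})"
    using assms by (simp add: sum.remove[of V b])
  moreover have "sum \<eta> V = Suc (sum \<eta> (V - {b}))"
    using assms by (simp add: sum.remove[of V b])
  ultimately show ?thesis using assms
    by (auto simp: level_def PiE_def Pi_def extensional_def)
qed

text \<open>Both sides run once over the pairs formed by a configuration and an extension of it by
  one particle.\<close>

lemma lowering_adjoint_raising:
  assumes "finite V"
  shows "(\<Sum>\<xi>\<in>level V k. g \<xi> * lowering V f \<xi>) = (\<Sum>\<eta>\<in>level V (Suc k). raising V g \<eta> * f \<eta>)"
proof -
  note fin = finite_level[OF assms]
  have "(\<Sum>\<xi>\<in>level V k. g \<xi> * lowering V f \<xi>)
      = (\<Sum>\<xi>\<in>level V k. \<Sum>b\<in>V. if \<xi> b = 0 then g \<xi> * f (\<xi>(b := 1)) else 0)"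
    using assms by (simp add: lowering_def sum_distrib_left flip: sum.inter_filter)
  also have "\<dots> = (\<Sum>b\<in>V. \<Sum>\<xi>\<in>level V k. if \<xi> b = 0 then g \<xi> * f (\<xi>(b := 1)) else 0)"
    by (rule sum.swap)
  also have "\<dots> = (\<Sum>b\<in>V. \<Sum>\<xi> | \<xi> \<in> level V k \<and> \<xi> b = 0. g \<xi> * f (\<xi>(b := 1)))"
    using fin by (simp flip: sum.inter_filter)
  also have "\<dots> = (\<Sum>b\<in>V. \<Sum>\<eta> | \<eta> \<in> level V (Suc k) \<and> \<eta> b = 1. g (\<eta>(b := 0)) * f \<eta>)"
  proof (rule sum.cong[OF refl])
    fix b assume b: "b \<in> V"
    show "(\<Sum>\<xi> | \<xi> \<in> level V k \<and> \<xi> b = 0. g \<xi> * f (\<xi>(b := 1)))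
        = (\<Sum>\<eta> | \<eta> \<in> level V (Suc k) \<and> \<eta> b = 1. g (\<eta>(b := 0)) * f \<eta>)"
      by (rule sum.reindex_bij_witness[where i="\<lambda>\<eta>. \<eta>(b := 0)" and j="\<lambda>\<xi>. \<xi>(b := 1)"])
        (use b assms in \<open>auto simp: fun_upd_idem intro: level_insert level_remove simp del: One_nat_def\<close>)
  qed
  also have "\<dots> = (\<Sum>b\<in>V. \<Sum>\<eta>\<in>level V (Suc k). if \<eta> b = 1 then g (\<eta>(b := 0)) * f \<eta> else 0)"
    using fin by (simp flip: sum.inter_filter)
  also have "\<dots> = (\<Sum>\<eta>\<in>level V (Suc k). \<Sum>b\<in>V. if \<eta> b = 1 then g (\<eta>(b := 0)) * f \<eta> else 0)"
    by (rule sum.swap)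
  also have "\<dots> = (\<Sum>\<eta>\<in>level V (Suc k). raising V g \<eta> * f \<eta>)"
    using assms by (simp add: raising_def sum_distrib_right flip: sum.inter_filter)
  finally show ?thesis .
qed

lemma lowering_raising:
  assumes "finite V" "\<eta> \<in> level V k"
  shows "lowering V (raising V g) \<eta> = (real (card V) - real k) * g \<eta>
     + (\<Sum>b | b \<in> V \<and> \<eta> b = 0. \<Sum>a | a \<in> V \<and> \<eta> a = 1. g (\<eta>(a := 0, b := 1)))"
proof -
  have "raising V g (\<eta>(b := 1)) = g \<eta> + (\<Sum>a | a \<in> V \<and> \<eta> a = 1. g (\<eta>(a := 0, b := 1)))"
    if b: "b \<in> V" "\<eta> b = 0" for b
  proof -
    have eq: "{a. a \<in> V \<and> (\<eta>(b := 1)) a = 1} = insert b {a. a \<in> V \<and> \<eta> a = 1}"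
      using b by auto
    have "\<eta>(b := 0) = \<eta>" using b by (simp add: fun_upd_idem)
    moreover have "(\<Sum>a | a \<in> V \<and> \<eta> a = 1. g (\<eta>(b := 1, a := 0)))
        = (\<Sum>a | a \<in> V \<and> \<eta> a = 1. g (\<eta>(a := 0, b := 1)))"
      using b by (intro sum.cong refl) (metis (mono_tags) fun_upd_twist mem_Collect_eq zero_neq_one)
    ultimately show ?thesis
      unfolding raising_def eq using b assms(1) by simp
  qed
  then have "lowering V (raising V g) \<eta> = (\<Sum>b | b \<in> V \<and> \<eta> b = 0.
      g \<eta> + (\<Sum>a | a \<in> V \<and> \<eta> a = 1. g (\<eta>(a := 0, b := 1))))"
    unfolding lowering_def by (intro sum.cong) auto
  moreover have "real (card {b \<in> V. \<eta> b = 0}) = real (card V) - real k"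
    using card_zeros[OF assms] by linarith
  ultimately show ?thesis by (simp add: sum.distrib)
qed

lemma raising_lowering:
  assumes "finite V" "\<eta> \<in> level V k"
  shows "raising V (lowering V g) \<eta> = real k * g \<eta>
     + (\<Sum>a | a \<in> V \<and> \<eta> a = 1. \<Sum>b | b \<in> V \<and> \<eta> b = 0. g (\<eta>(a := 0, b := 1)))"
proof -
  have "lowering V g (\<eta>(a := 0)) = g \<eta> + (\<Sum>b | b \<in> V \<and> \<eta> b = 0. g (\<eta>(a := 0, b := 1)))"
    if a: "a \<in> V" "\<eta> a = 1" for a
  proof -
    have eq: "{b. b \<in> V \<and> (\<eta>(a := 0)) b = 0} = insert a {b. b \<in> V \<and> \<eta> b = 0}"
      using a by auto
    have "\<eta>(a := 1) = \<eta>" using a by (metis fun_upd_idem)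
    then show ?thesis
      unfolding lowering_def eq using a assms(1) by simp
  qed
  then have "raising V (lowering V g) \<eta> = (\<Sum>a | a \<in> V \<and> \<eta> a = 1.
      g \<eta> + (\<Sum>b | b \<in> V \<and> \<eta> b = 0. g (\<eta>(a := 0, b := 1))))"
    unfolding raising_def by (intro sum.cong) auto
  moreover note card_ones[OF assms]
  ultimately show ?thesis by (simp add: sum.distrib)
qed

text \<open>Off the diagonal both products move one particle to an empty site. They differ in the
  number of ways to return to the start: card V - k by adding first, k by removing first.\<close>

lemma lowering_raising_commutator:
  assumes "finite V" "\<eta> \<in> level V k"
  shows "lowering V (raising V g) \<eta> = raising V (lowering V g) \<eta> + (real (card V) - 2 * real k) * g \<eta>"
  unfolding lowering_raising[OF assms] raising_lowering[OF assms]
  by (subst sum.swap) (simp add: algebra_simps)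

text \<open>Each configuration with k+1 particles extends k+1 configurations of level k. Hence
  \<open>lowering\<close> preserves mean zero, which the induction below needs in order to
  descend.\<close>

lemma sum_lowering:
  assumes "finite V"
  shows "(\<Sum>\<xi>\<in>level V k. lowering V f \<xi>) = real (Suc k) * (\<Sum>\<eta>\<in>level V (Suc k). f \<eta>)"
proof -
  have "(\<Sum>\<xi>\<in>level V k. 1 * lowering V f \<xi>) = (\<Sum>\<eta>\<in>level V (Suc k). raising V (\<lambda>_. 1) \<eta> * f \<eta>)"
    by (rule lowering_adjoint_raising[OF assms])
  also have "\<dots> = (\<Sum>\<eta>\<in>level V (Suc k). real (Suc k) * f \<eta>)"
  proof (rule sum.cong[OF refl])
    fix \<eta> assume "\<eta> \<in> level V (Suc k)"
    then show "raising V (\<lambda>_. 1) \<eta> * f \<eta> = real (Suc k) * f \<eta>"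
      using card_ones[OF assms, of \<eta> "Suc k"] by (simp add: raising_def)
  qed
  finally show ?thesis by (simp add: sum_distrib_left)
qed

lemma level_0: "finite V \<Longrightarrow> level V 0 = {restrict (\<lambda>_. 0) V}"
  unfolding level_def by (auto simp: PiE_def extensional_def Pi_def)

text \<open>With \<open>L = lowering V\<close> and adjoint \<open>L* = raising V\<close>, the nonzero spectra of \<open>L* L\<close> and \<open>L L*\<close>
  agree, so the commutator carries a bound on
  one level to the next; the sum of the shifts is \<open>k (N - k - 1)\<close>.\<close>

lemma lowering_norm_le:
  assumes "finite V" "Suc k \<le> card V" "(\<Sum>\<eta>\<in>level V (Suc k). f \<eta>) = 0"
  shows "(\<Sum>\<xi>\<in>level V k. (lowering V f \<xi>)\<^sup>2)
     \<le> real k * (real (card V) - real k - 1) * (\<Sum>\<eta>\<in>level V (Suc k). (f \<eta>)\<^sup>2)"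
  using assms(2,3)
proof (induction k arbitrary: f)
  case 0
  have "(\<Sum>\<xi>\<in>level V 0. lowering V f \<xi>) = 0"
    using sum_lowering[OF assms(1), of f 0] 0 by simp
  moreover obtain z where "level V 0 = {z :: 'a \<Rightarrow> nat}" using level_0[OF assms(1)] by blast
  ultimately show ?case by simp
next
  case (Suc j)
  let ?k = "Suc j" and ?g = "lowering V f"
  define G where "G = (\<Sum>\<xi>\<in>level V ?k. (?g \<xi>)\<^sup>2)"
  define F where "F = (\<Sum>\<eta>\<in>level V (Suc ?k). (f \<eta>)\<^sup>2)"
  define \<Lambda> where "\<Lambda> = real ?k * (real (card V) - real ?k - 1)"
  have "\<Lambda> \<ge> 0" using Suc.prems(1) unfolding \<Lambda>_def by (intro mult_nonneg_nonneg) auto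
  have "F \<ge> 0" "G \<ge> 0" unfolding F_def G_def by (auto intro: sum_nonneg)
  have mean: "(\<Sum>\<xi>\<in>level V ?k. ?g \<xi>) = 0"
    using sum_lowering[OF assms(1)] Suc.prems(2) by simp
  have "(\<Sum>\<eta>\<in>level V (Suc ?k). (raising V ?g \<eta>)\<^sup>2) = (\<Sum>\<xi>\<in>level V ?k. ?g \<xi> * lowering V (raising V ?g) \<xi>)"
    by (simp add: lowering_adjoint_raising[OF assms(1)] power2_eq_square)
  also have "\<dots> = (\<Sum>\<xi>\<in>level V ?k. raising V (lowering V ?g) \<xi> * ?g \<xi>
      + (real (card V) - 2 * real ?k) * (?g \<xi>)\<^sup>2)"
    by (intro sum.cong refl, subst lowering_raising_commutator[OF assms(1)], assumption)
      (simp add: algebra_simps power2_eq_square)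
  also have "\<dots> = (\<Sum>\<xi>\<in>level V j. (lowering V ?g \<xi>)\<^sup>2) + (real (card V) - 2 * real ?k) * G"
    by (simp add: sum.distrib sum_distrib_left G_def power2_eq_square
        flip: lowering_adjoint_raising[OF assms(1)])
  also have "\<dots> \<le> real j * (real (card V) - real j - 1) * G + (real (card V) - 2 * real ?k) * G"
    using Suc.IH[OF _ mean] Suc.prems(1) by (simp add: G_def)
  also have "\<dots> = \<Lambda> * G" unfolding \<Lambda>_def by (simp add: algebra_simps)
  finally have R: "(\<Sum>\<eta>\<in>level V (Suc ?k). (raising V ?g \<eta>)\<^sup>2) \<le> \<Lambda> * G" .
  \<comment> \<open>An operator and its adjoint have the same norm: from |L* g|^2 <= \<Lambda> |g|^2
    for g = L f, writing |g|^2 as the inner product of L* g and f gives |g|^2 <= \<Lambda> |f|^2 by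
    Cauchy-Schwarz.\<close>
  have "G = (\<Sum>\<eta>\<in>level V (Suc ?k). raising V ?g \<eta> * f \<eta>)"
    by (simp add: G_def power2_eq_square lowering_adjoint_raising[OF assms(1)])
  then have "G\<^sup>2 \<le> (\<Sum>\<eta>\<in>level V (Suc ?k). (raising V ?g \<eta>)\<^sup>2) * F"
    unfolding F_def using Cauchy_Schwarz_ineq_sum by metis
  also have "\<dots> \<le> \<Lambda> * G * F" using R \<open>F \<ge> 0\<close> by (rule mult_right_mono)
  finally have "G * G \<le> G * (\<Lambda> * F)" by (simp add: power2_eq_square mult_ac)
  then have "G \<le> \<Lambda> * F"
    using \<open>G \<ge> 0\<close> \<open>\<Lambda> \<ge> 0\<close> \<open>F \<ge> 0\<close> by (cases "G = 0") auto
  then show ?case unfolding G_def F_def \<Lambda>_def .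
qed

section \<open>Swaps and the complete graph\<close>

lemma exchange_commute: "exchange \<eta> x y = exchange \<eta> y x"
  by (auto simp: exchange_def fun_eq_iff)

lemma exchange_exchange [simp]: "exchange (exchange \<eta> x y) x y = \<eta>"
  by (auto simp: exchange_def fun_eq_iff)

lemma exchange_in_level:
  assumes "finite V" "\<eta> \<in> level V l" "x \<in> V" "y \<in> V"
  shows "exchange \<eta> x y \<in> level V l"
proof -
  have "sum (exchange \<eta> x y) V = sum \<eta> V"
    by (rule sum.reindex_bij_witness[where i="Transposition.transpose x y" and j="Transposition.transpose x y"])
      (use assms in \<open>auto simp: exchange_def Transposition.transpose_def split: if_splits\<close>)
  then show ?thesis using assms
    by (auto simp: level_def exchange_def PiE_def Pi_def extensional_def)
qed

lemma sum_level_exchange: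
  assumes "finite V" "x \<in> V" "y \<in> V"
  shows "(\<Sum>\<eta>\<in>level V l. g (exchange \<eta> x y) (f (exchange \<eta> x y)) \<eta>)
    = (\<Sum>\<eta>\<in>level V l. g \<eta> (f \<eta>) (exchange \<eta> x y))"
  by (rule sum.reindex_bij_witness[where i="\<lambda>\<eta>. exchange \<eta> x y" and j="\<lambda>\<eta>. exchange \<eta> x y"])
    (use assms in \<open>auto intro: exchange_in_level\<close>)

definition swap_energy :: "int set \<Rightarrow> nat \<Rightarrow> ((int \<Rightarrow> nat) \<Rightarrow> real) \<Rightarrow> int \<Rightarrow> int \<Rightarrow> real" where
  "swap_energy V l f x y = (\<Sum>\<eta>\<in>level V l. (f (exchange \<eta> x y) - f \<eta>)\<^sup>2)"

lemma swap_energy_nonneg: "0 \<le> swap_energy V l f x y"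
  unfolding swap_energy_def by (intro sum_nonneg) auto

lemma swap_energy_commute: "swap_energy V l f x y = swap_energy V l f y x"
  unfolding swap_energy_def by (simp add: exchange_commute)

lemma swap_energy_same [simp]: "swap_energy V l f x x = 0"
  unfolding swap_energy_def by (simp add: exchange_def)

text \<open>Reversibility: the exchange permutes the level, so both squares in the expanded energy
  have the same sum.\<close>

lemma sum_swap_form:
  fixes f :: "(int \<Rightarrow> nat) \<Rightarrow> real"
  assumes "finite V" "x \<in> V" "y \<in> V"
  shows "(\<Sum>\<eta>\<in>level V l. f \<eta> * (f (exchange \<eta> x y) - f \<eta>)) = - swap_energy V l f x y / 2"
proof -
  have "(\<Sum>\<eta>\<in>level V l. (f (exchange \<eta> x y))\<^sup>2) = (\<Sum>\<eta>\<in>level V l. (f \<eta>)\<^sup>2)"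
    by (rule sum_level_exchange[OF assms, of "\<lambda>_ u _. u\<^sup>2"])
  then have "swap_energy V l f x y
      = 2 * (\<Sum>\<eta>\<in>level V l. (f \<eta>)\<^sup>2) - 2 * (\<Sum>\<eta>\<in>level V l. f \<eta> * f (exchange \<eta> x y))"
    by (simp add: swap_energy_def power2_diff sum.distrib sum_subtractf sum_distrib_left mult_ac)
  then show ?thesis by (simp add: right_diff_distrib sum_subtractf power2_eq_square)
qed

text \<open>Only swaps of an occupied with an empty site change \<eta>, and ordered pairs list each
  of them twice. The product \<open>raising\<close> after \<open>lowering\<close> lists the same
  moves once, plus l returns to \<eta>.\<close>

lemma sum_all_exchanges:
  assumes "finite V" "\<eta> \<in> level V l"
  shows "(\<Sum>x\<in>V. \<Sum>y\<in>V. f (exchange \<eta> x y) - f \<eta>)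
    = 2 * raising V (lowering V f) \<eta> - 2 * real l * (real (card V) - real l + 1) * f \<eta>"
proof -
  let ?O = "{a \<in> V. \<eta> a = 1}" and ?Z = "{b \<in> V. \<eta> b = 0}"
  have V: "V = ?O \<union> ?Z" using level_values[OF assms(2)] by blast
  have split: "sum h V = sum h ?O + sum h ?Z" for h :: "int \<Rightarrow> real"
    by (subst V, rule sum.union_disjoint) (use assms(1) in auto)
  define X where "X = (\<Sum>a\<in>?O. \<Sum>b\<in>?Z. f (\<eta>(a := 0, b := 1)))"
  have cO: "real (card ?O) = real l" using card_ones[OF assms] by simp
  have cZ: "real (card ?Z) = real (card V) - real l" using card_zeros[OF assms] by linarith
  have same: "exchange \<eta> x y = \<eta>" if "\<eta> x = \<eta> y" for x y
    using that by (auto simp: exchange_def)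
  have OZ: "(\<Sum>x\<in>?O. \<Sum>y\<in>?Z. f (exchange \<eta> x y) - f \<eta>)
      = X - real l * (real (card V) - real l) * f \<eta>"
    unfolding X_def by (simp add: exchange_def sum_subtractf cO cZ del: One_nat_def)
  moreover have "(\<Sum>x\<in>?Z. \<Sum>y\<in>?O. f (exchange \<eta> x y) - f \<eta>)
      = (\<Sum>x\<in>?O. \<Sum>y\<in>?Z. f (exchange \<eta> x y) - f \<eta>)"
    by (subst sum.swap) (simp add: exchange_commute)
  moreover have "(\<Sum>x\<in>?O. \<Sum>y\<in>?O. f (exchange \<eta> x y) - f \<eta>) = 0"
    "(\<Sum>x\<in>?Z. \<Sum>y\<in>?Z. f (exchange \<eta> x y) - f \<eta>) = 0"
    by (simp_all add: same)
  ultimately have "(\<Sum>x\<in>V. \<Sum>y\<in>V. f (exchange \<eta> x y) - f \<eta>)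
      = 2 * X - 2 * real l * (real (card V) - real l) * f \<eta>"
    unfolding split sum.distrib by simp
  moreover have "X = raising V (lowering V f) \<eta> - real l * f \<eta>"
    unfolding raising_lowering[OF assms] X_def by simp
  ultimately show ?thesis by (simp add: algebra_simps)
qed

text \<open>With N = card V, the two eigenvalue expressions differ by l (N - l + 1) - (l - 1) (N -
  l) = N, in which l has cancelled. The factor 4 is 2 for ordered pairs times 2 from
  \<open>sum_swap_form\<close>.\<close>

lemma complete_graph_poincare:
  fixes f :: "(int \<Rightarrow> nat) \<Rightarrow> real"
  assumes "finite V" "l \<le> card V" "(\<Sum>\<eta>\<in>level V l. f \<eta>) = 0"
  shows "4 * real (card V) * (\<Sum>\<eta>\<in>level V l. (f \<eta>)\<^sup>2) \<le> (\<Sum>x\<in>V. \<Sum>y\<in>V. swap_energy V l f x y)"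
proof (cases l)
  case 0
  obtain z where "level V 0 = {z :: int \<Rightarrow> nat}" using level_0[OF assms(1)] by blast
  then show ?thesis using assms(3) 0 by (simp add: swap_energy_nonneg sum_nonneg)
next
  case (Suc k)
  define F where "F = (\<Sum>\<eta>\<in>level V l. (f \<eta>)\<^sup>2)"
  have "(\<Sum>x\<in>V. \<Sum>y\<in>V. swap_energy V l f x y)
      = -2 * (\<Sum>x\<in>V. \<Sum>y\<in>V. \<Sum>\<eta>\<in>level V l. f \<eta> * (f (exchange \<eta> x y) - f \<eta>))"
    using assms(1) by (simp add: sum_swap_form sum_negf flip: sum_divide_distrib)
  also have "(\<Sum>x\<in>V. \<Sum>y\<in>V. \<Sum>\<eta>\<in>level V l. f \<eta> * (f (exchange \<eta> x y) - f \<eta>))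
      = (\<Sum>\<eta>\<in>level V l. f \<eta> * (\<Sum>x\<in>V. \<Sum>y\<in>V. f (exchange \<eta> x y) - f \<eta>))"
    by (simp only: sum_distrib_left sum.swap[of _ "level V l"])
  also have "\<dots> = (\<Sum>\<eta>\<in>level V l. 2 * (raising V (lowering V f) \<eta> * f \<eta>)
      - 2 * real l * (real (card V) - real l + 1) * (f \<eta>)\<^sup>2)"
    using assms(1) by (intro sum.cong refl)
      (simp add: sum_all_exchanges right_diff_distrib power2_eq_square mult_ac)
  also have "\<dots> = 2 * (\<Sum>\<xi>\<in>level V k. (lowering V f \<xi>)\<^sup>2) - 2 * real l * (real (card V) - real l + 1) * F"
    by (simp add: sum_subtractf F_def power2_eq_square Suc lowering_adjoint_raising[OF assms(1)]
        flip: sum_distrib_left)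
  finally have "(\<Sum>x\<in>V. \<Sum>y\<in>V. swap_energy V l f x y)
      = 4 * real l * (real (card V) - real l + 1) * F - 4 * (\<Sum>\<xi>\<in>level V k. (lowering V f \<xi>)\<^sup>2)"
    by simp
  moreover have "(\<Sum>\<xi>\<in>level V k. (lowering V f \<xi>)\<^sup>2) \<le> real k * (real (card V) - real k - 1) * F"
    unfolding F_def Suc using assms Suc by (intro lowering_norm_le) auto
  moreover have "real l * (real (card V) - real l + 1) - real k * (real (card V) - real k - 1) = real (card V)"
    using Suc by (simp add: algebra_simps)
  then have "4 * real l * (real (card V) - real l + 1) * F - 4 * (real k * (real (card V) - real k - 1) * F)
      = 4 * real (card V) * F"
    by (metis (no_types, opaque_lifting) left_diff_distrib mult.assoc right_diff_distrib)
  ultimately show ?thesis unfolding F_def by linarith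
qed

section \<open>Energies by distance\<close>

definition shift_energy :: "int set \<Rightarrow> nat \<Rightarrow> ((int \<Rightarrow> nat) \<Rightarrow> real) \<Rightarrow> nat \<Rightarrow> real" where
  "shift_energy V l f t = (\<Sum>x | x \<in> V \<and> x + int t \<in> V. swap_energy V l f x (x + int t))"

lemma shift_energy_nonneg: "0 \<le> shift_energy V l f t"
  unfolding shift_energy_def by (intro sum_nonneg swap_energy_nonneg)

lemma shift_energy_0 [simp]: "shift_energy V l f 0 = 0"
  unfolding shift_energy_def by simp

lemma exchange_via:
  assumes "x \<noteq> y" "y \<noteq> z" "x \<noteq> z"
  shows "exchange (exchange (exchange \<eta> x y) y z) x y = exchange \<eta> x z"
  using assms by (auto simp: exchange_def fun_eq_iff)

lemma sum_level_exchange_arg: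
  assumes "finite V" "x \<in> V" "y \<in> V"
  shows "(\<Sum>\<eta>\<in>level V l. h (exchange \<eta> x y)) = (\<Sum>\<eta>\<in>level V l. h \<eta>)"
  using sum_level_exchange[OF assms, of "\<lambda>_ u _. u" h] .

text \<open>The swap of x and x+s+t is the swap of x+s and x+s+t conjugated by the swap of x and
  x+s; the conjugating step occurs twice, hence the coefficient 2. The triangle inequality is
  applied in L2 over the pairs of a left end x and a configuration. An interval of sites guarantees
  that the intermediate site x+s is available.\<close>

lemma sqrt_shift_energy_add:
  "sqrt (shift_energy {a..b} l f (s + t)) \<le> 2 * sqrt (shift_energy {a..b} l f s) + sqrt (shift_energy {a..b} l f t)"
proof (cases "s = 0 \<or> t = 0")
  case True
  then show ?thesis using shift_energy_nonneg[of "{a..b}" l f] by auto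
next
  case False
  define V where "V = {a..b}"
  define A where "A = {x. x \<in> V \<and> x + int (s + t) \<in> V}"
  have V: "finite V" unfolding V_def by simp
  have A: "finite A" using V unfolding A_def by (rule rev_finite_subset) auto
  have mem: "x \<in> V" "x + int s \<in> V" "x + int s + int t \<in> V" if "x \<in> A" for x
    using that unfolding A_def V_def by auto
  let ?I = "A \<times> level V l"
  \<comment> \<open>\<xi> and \<zeta> are the configurations after one and two of the three swaps.
    For fixed x both are bijective images of \<eta> within the level, so each increment sums to an
    ordinary swap energy.\<close>
  define \<xi> where "\<xi> \<eta> x = exchange \<eta> x (x + int s)" for \<eta> :: "int \<Rightarrow> nat" and x
  define \<zeta> where "\<zeta> \<eta> x = exchange (\<xi> \<eta> x) (x + int s) (x + int s + int t)" for \<eta> :: "int \<Rightarrow> nat" and x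
  define g1 where "g1 = (\<lambda>(x, \<eta>). f (\<xi> (\<zeta> \<eta> x) x) - f (\<zeta> \<eta> x))"
  define g2 where "g2 = (\<lambda>(x, \<eta>). f (\<zeta> \<eta> x) - f (\<xi> \<eta> x))"
  define g3 where "g3 = (\<lambda>(x, \<eta>). f (\<xi> \<eta> x) - f \<eta>)"
  have L2: "L2_set g ?I = sqrt (\<Sum>x\<in>A. \<Sum>\<eta>\<in>level V l. (g (x, \<eta>))\<^sup>2)" for g :: "int \<times> (int \<Rightarrow> nat) \<Rightarrow> real"
    by (simp add: L2_set_def sum.cartesian_product split_def)
  have mono: "sqrt (\<Sum>x\<in>A. swap_energy V l f x (x + int s)) \<le> sqrt (shift_energy V l f s)"
    unfolding shift_energy_def using mem V
    by (intro real_sqrt_le_mono sum_mono2 swap_energy_nonneg) auto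
  have "sqrt (shift_energy V l f (s + t)) = L2_set (\<lambda>i. (g1 i + g2 i) + g3 i) ?I"
    unfolding L2 shift_energy_def swap_energy_def A_def[symmetric] g1_def g2_def g3_def \<xi>_def \<zeta>_def
    using False by (simp add: exchange_via add.assoc)
  also have "\<dots> \<le> L2_set (\<lambda>i. g1 i + g2 i) ?I + L2_set g3 ?I"
    by (rule L2_set_triangle_ineq)
  also have "\<dots> \<le> L2_set g1 ?I + L2_set g2 ?I + L2_set g3 ?I"
    by (intro add_right_mono L2_set_triangle_ineq)
  also have "L2_set g3 ?I \<le> sqrt (shift_energy V l f s)"
    using mono unfolding L2 g3_def \<xi>_def by (simp add: swap_energy_def)
  also have "L2_set g1 ?I = sqrt (\<Sum>x\<in>A. swap_energy V l f x (x + int s))"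
  proof -
    have "(\<Sum>\<eta>\<in>level V l. (g1 (x, \<eta>))\<^sup>2) = swap_energy V l f x (x + int s)" if "x \<in> A" for x
    proof -
      let ?h = "\<lambda>\<eta>. (f (exchange \<eta> x (x + int s)) - f \<eta>)\<^sup>2"
      have "(\<Sum>\<eta>\<in>level V l. (g1 (x, \<eta>))\<^sup>2) = (\<Sum>\<eta>\<in>level V l. ?h (\<zeta> \<eta> x))"
        by (simp add: g1_def \<xi>_def)
      also have "\<dots> = (\<Sum>\<eta>\<in>level V l. ?h (exchange \<eta> (x + int s) (x + int s + int t)))"
        unfolding \<zeta>_def \<xi>_def using V mem[OF that]
        by (intro sum_level_exchange_arg[where h="\<lambda>\<eta>. ?h (exchange \<eta> (x + int s) (x + int s + int t))"])
      also have "\<dots> = (\<Sum>\<eta>\<in>level V l. ?h \<eta>)"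
        using V mem[OF that] by (intro sum_level_exchange_arg[where h="?h"])
      finally show ?thesis by (simp add: swap_energy_def)
    qed
    then show ?thesis unfolding L2 by simp
  qed
  also note mono
  also have "L2_set g2 ?I \<le> sqrt (shift_energy V l f t)"
  proof -
    have "(\<Sum>\<eta>\<in>level V l. (g2 (x, \<eta>))\<^sup>2) = swap_energy V l f (x + int s) (x + int s + int t)"
      if "x \<in> A" for x
      unfolding g2_def \<zeta>_def \<xi>_def swap_energy_def prod.case using V mem[OF that]
      by (intro sum_level_exchange_arg[where h="\<lambda>\<eta>. (f (exchange \<eta> (x + int s) (x + int s + int t)) - f \<eta>)\<^sup>2"])
    then have "(\<Sum>x\<in>A. \<Sum>\<eta>\<in>level V l. (g2 (x, \<eta>))\<^sup>2)
        = (\<Sum>x\<in>A. swap_energy V l f (x + int s) (x + int s + int t))" by simp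
    also have "\<dots> = (\<Sum>y\<in>(\<lambda>x. x + int s) ` A. swap_energy V l f y (y + int t))"
      by (subst sum.reindex) (auto simp: inj_on_def)
    also have "\<dots> \<le> shift_energy V l f t"
      unfolding shift_energy_def using mem V by (intro sum_mono2 swap_energy_nonneg) auto
    finally show ?thesis unfolding L2 by (rule real_sqrt_le_mono)
  qed
  finally show ?thesis unfolding V_def by simp
qed

text \<open>Applied with \<open>h = p\<close> to the Dirichlet form and with h = 1 to the complete
  graph, this expresses both through the same energies by distance. The diagonal vanishes and the
  two orders of a pair contribute equally.\<close>

lemma sum_even_weight_swap_energy:
  fixes h :: "int \<Rightarrow> real"
  assumes even: "\<And>z. h (- z) = h z" and M: "b - a \<le> int M"
  shows "(\<Sum>x=a..b. \<Sum>y=a..b. h (y - x) * swap_energy {a..b} l f x y)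
    = 2 * (\<Sum>t=1..M. h (int t) * shift_energy {a..b} l f t)"
proof -
  let ?V = "{a..b}"
  define G where "G = (\<lambda>(x, y). h (y - x) * swap_energy ?V l f x y)"
  have sym: "G (x, y) = G (y, x)" for x y
    using even[of "y - x"] by (simp add: G_def swap_energy_commute)
  let ?U = "{(x, y). x \<in> ?V \<and> y \<in> ?V \<and> x < y}" and ?L = "{(x, y). x \<in> ?V \<and> y \<in> ?V \<and> y < x}"
    and ?D = "{(x, y). x \<in> ?V \<and> y \<in> ?V \<and> x = y}"
  have fin: "finite ?U" "finite ?L" "finite ?D"
    by (rule finite_subset[of _ "?V \<times> ?V"]; auto)+
  have "(\<Sum>x=a..b. \<Sum>y=a..b. h (y - x) * swap_energy ?V l f x y) = sum G (?V \<times> ?V)"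
    by (simp add: G_def sum.cartesian_product)
  also have "?V \<times> ?V = ?U \<union> (?L \<union> ?D)" by auto
  also have "sum G (?U \<union> (?L \<union> ?D)) = sum G ?U + (sum G ?L + sum G ?D)"
    using fin by (subst sum.union_disjoint, auto)+
  also have "sum G ?D = 0" by (intro sum.neutral) (auto simp: G_def)
  also have "sum G ?L = sum G ?U"
    by (rule sum.reindex_bij_witness[where i=prod.swap and j=prod.swap]) (auto simp: sym)
  also have "sum G ?U = (\<Sum>(t, x)\<in>(SIGMA t:{1..M}. {x. x \<in> ?V \<and> x + int t \<in> ?V}). G (x, x + int t))"
    by (rule sum.reindex_bij_witness[where i="\<lambda>(t, x). (x, x + int t)" and j="\<lambda>(x, y). (nat (y - x), x)"])
      (use M in auto)
  also have "\<dots> = (\<Sum>t=1..M. \<Sum>x | x \<in> ?V \<and> x + int t \<in> ?V. G (x, x + int t))"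
    by (subst sum.Sigma) (auto intro: finite_subset[of _ ?V])
  also have "\<dots> = (\<Sum>t=1..M. h (int t) * shift_energy ?V l f t)"
    by (simp add: G_def shift_energy_def sum_distrib_left)
  finally show ?thesis by simp
qed

section \<open>The exclusion generator on a level and its Dirichlet form\<close>

lemma \<Omega>_ex_level_eq: "\<Omega>_ex_level n l = level (box n) l"
  by (auto simp: \<Omega>_ex_level_def \<Omega>_ex_def level_def)

lemma L_ex_symmetric:
  assumes p: "symmetric_rate p" and \<eta>: "\<eta> \<in> level (box n) l"
  shows "L_ex p n f \<eta> = (\<Sum>x\<in>box n. \<Sum>y\<in>box n. p (y - x) * (f (exchange \<eta> x y) - f \<eta>)) / 2"
proof -
  have p': "p (x - y) = p (y - x)" for x y
    using p unfolding symmetric_rate_def by (metis minus_diff_eq)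
  have "L_ex p n f \<eta> = (\<Sum>x\<in>box n. \<Sum>y\<in>box n.
      p (y - x) * real (\<eta> y) * (1 - real (\<eta> x)) * (f (exchange \<eta> x y) - f \<eta>))"
    unfolding L_ex_def by (subst sum.swap) (simp add: p' exchange_commute)
  then have "2 * L_ex p n f \<eta> = (\<Sum>x\<in>box n. \<Sum>y\<in>box n.
      p (y - x) * real (\<eta> x) * (1 - real (\<eta> y)) * (f (exchange \<eta> x y) - f \<eta>)
      + p (y - x) * real (\<eta> y) * (1 - real (\<eta> x)) * (f (exchange \<eta> x y) - f \<eta>))"
    unfolding sum.distrib by (simp add: L_ex_def)
  also have "\<dots> = (\<Sum>x\<in>box n. \<Sum>y\<in>box n. p (y - x) * (f (exchange \<eta> x y) - f \<eta>))"
  proof (intro sum.cong refl)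
    fix x y assume xy: "x \<in> box n" "y \<in> box n"
    have same: "exchange \<eta> x y = \<eta>" if "\<eta> x = \<eta> y"
      using that by (auto simp: exchange_def)
    show "p (y - x) * real (\<eta> x) * (1 - real (\<eta> y)) * (f (exchange \<eta> x y) - f \<eta>)
      + p (y - x) * real (\<eta> y) * (1 - real (\<eta> x)) * (f (exchange \<eta> x y) - f \<eta>)
      = p (y - x) * (f (exchange \<eta> x y) - f \<eta>)"
      using level_values[OF \<eta> xy(1)] level_values[OF \<eta> xy(2)] same by auto
  qed
  finally show ?thesis by simp
qed

lemma finite_box: "finite (box n)"
  by (simp add: box_def)

lemma card_box: "card (box n) = 2 * n + 1"
  by (simp add: box_def)

text \<open>Invariance of the uniform measure; it forces eigenfunctions with a non-zero eigenvalue
  to have mean zero.\<close>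

lemma sum_L_ex:
  assumes p: "symmetric_rate p"
  shows "(\<Sum>\<eta>\<in>level (box n) l. L_ex p n f \<eta>) = 0"
proof -
  have "(\<Sum>\<eta>\<in>level (box n) l. L_ex p n f \<eta>) = (\<Sum>x\<in>box n. \<Sum>y\<in>box n. p (y - x) *
      (\<Sum>\<eta>\<in>level (box n) l. f (exchange \<eta> x y) - f \<eta>)) / 2"
    by (simp add: L_ex_symmetric[OF p] sum_divide_distrib[symmetric] sum_distrib_left sum.swap[of _ "level (box n) l"])
  also have "\<dots> = 0"
    using finite_box by (simp add: sum_subtractf sum_level_exchange_arg)
  finally show ?thesis .
qed

lemma dirichlet_form:
  assumes p: "symmetric_rate p"
  shows "(\<Sum>\<eta>\<in>level (box n) l. f \<eta> * - L_ex p n f \<eta>)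
    = (\<Sum>t=1..2*n. p (int t) * shift_energy (box n) l f t) / 2"
proof -
  have "(\<Sum>\<eta>\<in>level (box n) l. f \<eta> * - L_ex p n f \<eta>) = - (\<Sum>x\<in>box n. \<Sum>y\<in>box n. p (y - x) *
      (\<Sum>\<eta>\<in>level (box n) l. f \<eta> * (f (exchange \<eta> x y) - f \<eta>))) / 2"
    by (simp add: L_ex_symmetric[OF p] sum_divide_distrib[symmetric] sum_negf sum_distrib_left mult.left_commute
      sum.swap[of _ "level (box n) l"])
  also have "\<dots> = (\<Sum>x\<in>box n. \<Sum>y\<in>box n. p (y - x) * swap_energy (box n) l f x y) / 4"
    by (simp add: sum_swap_form[OF finite_box] sum_negf flip: sum_divide_distrib)
  also have "\<dots> = (\<Sum>t=1..2*n. p (int t) * shift_energy (box n) l f t) / 2"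
    unfolding box_def using p
    by (subst sum_even_weight_swap_energy[where M="2*n"]) (auto simp: symmetric_rate_def)
  finally show ?thesis .
qed

section \<open>A multiscale comparison\<close>

lemma sum_mod_le:
  fixes E :: "nat \<Rightarrow> real"
  assumes "\<And>t. 0 \<le> E t" "0 < d"
  shows "(\<Sum>t\<le>m. E (t mod d)) \<le> real (m div d + 1) * (\<Sum>j<d. E j)"
proof -
  let ?q = "m div d + 1"
  have "m < ?q * d" using assms(2) by (metis Suc_eq_plus1 dividend_less_div_times mult_Suc add.commute)
  then have "(\<Sum>t\<le>m. E (t mod d)) \<le> (\<Sum>t<?q * d. E (t mod d))"
    using assms(1) by (intro sum_mono2) auto
  also have "\<dots> = (\<Sum>i<?q. \<Sum>t=i*d..<i*d+d. E (t mod d))"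
    by (rule sum.nat_group[symmetric])
  also have "\<dots> = (\<Sum>i<?q. \<Sum>j<d. E j)"
  proof (rule sum.cong[OF refl])
    fix i
    show "(\<Sum>t=i*d..<i*d+d. E (t mod d)) = (\<Sum>j<d. E j)"
      by (rule sum.reindex_bij_witness[where i="\<lambda>j. i * d + j" and j="\<lambda>t. t - i * d"])
        (auto simp: mod_mult_self3 le_mod_geq dest: le_Suc_ex)
  qed
  finally show ?thesis by simp
qed

text \<open>The expensive slot is always filled by d, so the remainder j keeps coefficient 1 however
  large k is. A symmetric inequality with 2 in both slots would give 2^k here.\<close>

lemma division_bound:
  fixes e :: "nat \<Rightarrow> real"
  assumes "\<And>s t. e (s + t) \<le> 2 * e s + e t"
  shows "e (k * d + j) \<le> 2 * real k * e d + e j"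
proof (induction k)
  case (Suc k)
  have "e (Suc k * d + j) \<le> 2 * e d + e (k * d + j)"
    using assms[of d "k * d + j"] by (simp add: algebra_simps)
  then show ?case using Suc by (simp add: algebra_simps)
qed simp

text \<open>The factor in front of the energies below distance \<open>d\<close> does not deteriorate, after division
  by \<open>m\<close>, as \<open>m / d\<close> grows; this lets the induction over scales close.\<close>

lemma scale_reduction:
  fixes e :: "nat \<Rightarrow> real"
  assumes tri: "\<And>s t. e (s + t) \<le> 2 * e s + e t" and nn: "\<And>t. 0 \<le> e t"
    and d: "0 < d" "d \<le> m"
  shows "(\<Sum>t\<le>m. (e t)\<^sup>2) \<le> 4 * (real m / real d) * (\<Sum>j<d. (e j)\<^sup>2)
     + 16 * real m * (real m / real d)\<^sup>2 * (e d)\<^sup>2"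
proof -
  let ?r = "real m / real d"
  have r1: "1 \<le> ?r" using d by simp
  have divr: "real (m div d) \<le> ?r" by (rule of_nat_div_le_of_nat)
  have "(e t)\<^sup>2 \<le> 2 * (e (t mod d))\<^sup>2 + 8 * ?r\<^sup>2 * (e d)\<^sup>2" if "t \<le> m" for t
  proof -
    have "e t \<le> 2 * real (t div d) * e d + e (t mod d)"
      using division_bound[of e "t div d" d "t mod d", OF tri] by simp
    also have "\<dots> \<le> 2 * ?r * e d + e (t mod d)"
    proof -
      have "real (t div d) \<le> ?r" using divr div_le_mono[OF that, of d] by linarith
      then show ?thesis using nn[of d] by (intro add_right_mono mult_right_mono mult_left_mono) auto
    qed
    finally have "(e t)\<^sup>2 \<le> (2 * ?r * e d + e (t mod d))\<^sup>2" using nn by (simp add: power_mono)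
    also have "\<dots> \<le> 2 * (2 * ?r * e d)\<^sup>2 + 2 * (e (t mod d))\<^sup>2"
      using sum_squares_bound[of "2 * ?r * e d" "e (t mod d)"] by (simp add: power2_sum)
    finally show ?thesis by (simp add: power_mult_distrib power_divide)
  qed
  then have "(\<Sum>t\<le>m. (e t)\<^sup>2) \<le> (\<Sum>t\<le>m. 2 * (e (t mod d))\<^sup>2 + 8 * ?r\<^sup>2 * (e d)\<^sup>2)"
    by (intro sum_mono) auto
  also have "\<dots> = 2 * (\<Sum>t\<le>m. (e (t mod d))\<^sup>2) + 8 * (real m + 1) * ?r\<^sup>2 * (e d)\<^sup>2"
    by (simp add: sum.distrib sum_distrib_left)
  \<comment> \<open>As 1 <= d <= m, both m div d + 1 <= 2 m/d and m + 1 <= 2 m; this yields the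
    constants 4 and 16.\<close>
  also have "\<dots> \<le> 2 * (2 * ?r * (\<Sum>j<d. (e j)\<^sup>2)) + 8 * (2 * real m) * ?r\<^sup>2 * (e d)\<^sup>2"
  proof -
    have "(\<Sum>t\<le>m. (e (t mod d))\<^sup>2) \<le> real (m div d + 1) * (\<Sum>j<d. (e j)\<^sup>2)"
      using sum_mod_le[of "\<lambda>t. (e t)\<^sup>2" d m] d by simp
    also have "\<dots> \<le> 2 * ?r * (\<Sum>j<d. (e j)\<^sup>2)"
      using divr r1 by (intro mult_right_mono sum_nonneg) auto
    finally have 1: "(\<Sum>t\<le>m. (e (t mod d))\<^sup>2) \<le> 2 * ?r * (\<Sum>j<d. (e j)\<^sup>2)" .
    have "8 * (real m + 1) * ?r\<^sup>2 * (e d)\<^sup>2 \<le> 8 * (2 * real m) * ?r\<^sup>2 * (e d)\<^sup>2"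
      using d by (intro mult_right_mono) auto
    with 1 show ?thesis by linarith
  qed
  finally show ?thesis by (simp add: mult_ac)
qed

text \<open>Here \<open>e t\<close> is the square root of E_t and \<open>w\<close> is the jump rate.
  C is chosen before e, M and m, so one constant serves all boxes, levels and functions. M is kept
  apart from m so that the Dirichlet sum stays fixed while the induction descends to smaller
  scales.\<close>

lemma multiscale_bound:
  fixes w :: "nat \<Rightarrow> real"
  assumes \<alpha>: "0 < \<alpha>" and w: "\<And>d. 0 \<le> w d" "0 < w 1" and c: "0 < c"
    and mass: "\<And>s. s0 \<le> s \<Longrightarrow> c * real s powr (-\<alpha>) \<le> (\<Sum>d=s..<2 * s. w d)"
  shows "\<exists>C>0. \<forall>e M m. (\<forall>s t. e (s + t) \<le> 2 * e s + e t) \<longrightarrow> (\<forall>t. 0 \<le> e t) \<longrightarrow> e 0 = 0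
    \<longrightarrow> 1 \<le> m \<longrightarrow> m \<le> M
    \<longrightarrow> (\<Sum>t\<le>m. (e t)\<^sup>2) \<le> C * real m powr (1 + \<alpha>) * (\<Sum>d=1..M. w d * (e d)\<^sup>2)"
proof -
  \<comment> \<open>R >= 3 makes the next scale 2s, with s = m div R, strictly smaller than m; the
    second condition is the contraction 8 (2/R)^\<alpha> <= 1/2.\<close>
  obtain R :: nat where R: "3 \<le> R" "16 powr (1/\<alpha>) \<le> real R / 2"
  proof -
    obtain R0 :: nat where "2 * 16 powr (1/\<alpha>) \<le> real R0" using real_arch_simple by blast
    then show ?thesis using that[of "max 3 R0"] by auto
  qed
  have RR: "8 * (2 / real R) powr \<alpha> \<le> 1/2"
  proof -
    have "16 \<le> (real R / 2) powr \<alpha>"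
      using powr_mono2[of \<alpha> "16 powr (1/\<alpha>)" "real R / 2"] \<alpha> R by (simp add: powr_powr)
    moreover have "(2 / real R) powr \<alpha> * (real R / 2) powr \<alpha> = 1"
      using R by (simp flip: powr_mult)
    ultimately have "(2 / real R) powr \<alpha> * 16 \<le> 1"
      using mult_left_mono[of 16 "(real R / 2) powr \<alpha>" "(2 / real R) powr \<alpha>"] by simp
    then show ?thesis by simp
  qed
  \<comment> \<open>From m0 on, s = m div R exceeds s0, so \<open>mass\<close> applies. In C the
    first summand settles m < m0 using \<open>w 1\<close>, and half of the second absorbs the
    Dirichlet term of the recursion.\<close>
  define m0 where "m0 = R * (s0 + 1)"
  define C where "C = 16 * real m0 ^ 3 / w 1 + 128 * (real R)\<^sup>2 / c"
  have Cpos: "0 < C" unfolding C_def using w c R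
    by (intro add_nonneg_pos divide_pos_pos divide_nonneg_pos) auto
  have C1: "16 * real m0 ^ 3 / w 1 \<le> C" unfolding C_def using c by simp
  have C2: "64 * (real R)\<^sup>2 / c \<le> C / 2" unfolding C_def using w(2) by simp
  have "(\<Sum>t\<le>m. (e t)\<^sup>2) \<le> C * real m powr (1 + \<alpha>) * (\<Sum>d=1..M. w d * (e d)\<^sup>2)"
    if tri: "\<And>s t. e (s + t) \<le> 2 * e s + e t" and nn: "\<And>t. 0 \<le> e t" and e0: "e 0 = 0"
      and m: "1 \<le> m" "m \<le> M" for e :: "nat \<Rightarrow> real" and M m
  proof -
    define D where "D = (\<Sum>d=1..M. w d * (e d)\<^sup>2)"
    have D0: "0 \<le> D" unfolding D_def using w by (intro sum_nonneg) auto
    define S where "S m = (\<Sum>t\<le>m. (e t)\<^sup>2)" for m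
    have "1 \<le> m \<Longrightarrow> m \<le> M \<Longrightarrow> S m \<le> C * real m powr (1 + \<alpha>) * D" for m
    proof (induction m rule: less_induct)
      case (less m)
      show ?case
      proof (cases "m < m0")
        case True
        \<comment> \<open>For d = 1 the only remainder is 0, where e vanishes, so only the
          \<open>e 1\<close> term survives.\<close>
        have "S m \<le> 16 * real m ^ 3 * (e 1)\<^sup>2"
          using scale_reduction[of e 1 m, OF tri nn] less.prems(1) e0
          unfolding S_def by (simp add: power3_eq_cube power2_eq_square mult_ac)
        also have "\<dots> \<le> 16 * real m0 ^ 3 * (e 1)\<^sup>2"
          using True by (intro mult_right_mono mult_left_mono power_mono) auto
        also have "\<dots> = 16 * real m0 ^ 3 / w 1 * (w 1 * (e 1)\<^sup>2)" using w(2) by simp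
        also have "\<dots> \<le> C * D"
        proof (intro mult_mono C1)
          have "sum (\<lambda>d. w d * (e d)\<^sup>2) {1} \<le> D" unfolding D_def
            using less.prems w(1) by (intro sum_mono2) auto
          then show "w 1 * (e 1)\<^sup>2 \<le> D" by simp
        qed (use Cpos w in auto)
        also have "\<dots> \<le> C * real m powr (1 + \<alpha>) * D"
        proof -
          have "1 \<le> real m powr (1 + \<alpha>)" using less.prems(1) \<alpha> by (intro ge_one_powr_ge_zero) auto
          then show ?thesis using Cpos D0 by (intro mult_right_mono) auto
        qed
        finally show ?thesis .
      next
        case False
        define s where "s = m div R"
        have mR: "R * (s0 + 1) \<le> m" using False by (simp add: m0_def)
        then have s: "s0 + 1 \<le> s" unfolding s_def using R
          by (simp add: less_eq_div_iff_mult_less_eq mult.commute)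
        have "R * s \<le> m" unfolding s_def by simp
        then have sR: "real s \<le> real m / real R" using R
          by (simp add: field_simps flip: of_nat_mult)
        have "2 * s < R * s" using R s by simp
        with \<open>R * s \<le> m\<close> have s2: "2 * s < m" by linarith
        have "m < R * s + R" unfolding s_def using R
          mod_less_divisor[of R m] mult_div_mod_eq[of R m] by linarith
        also have "\<dots> \<le> 2 * R * s" using s R by (simp add: Suc_le_eq)
        finally have "real m \<le> 2 * real R * real s"
          by (metis less_imp_le of_nat_le_iff of_nat_mult of_nat_numeral)
        then have ms: "real m / real s \<le> 2 * real R" using s by (simp add: divide_le_eq)
        have mpos: "0 < real m" and spos: "0 < real s" using less.prems s by auto
        define B where "B = C * real (2 * s) powr (1 + \<alpha>) * D"
        have "S (2 * s) \<le> B" unfolding B_def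
          using less.IH[OF s2] s s2 less.prems by simp
        \<comment> \<open>The left side does not involve d, so these bounds can be averaged with
          weights \<open>w d\<close>. Single weights may be zero; what counts is the mass W of the
          block, by which the result is divided.\<close>
        have each: "S m \<le> 4 * (real m / real s) * B + 16 * real m * (real m / real s)\<^sup>2 * (e d)\<^sup>2"
          if d: "s \<le> d" "d < 2 * s" for d
        proof -
          have "(\<Sum>j<d. (e j)\<^sup>2) \<le> S (2 * s)" unfolding S_def
            using d by (intro sum_mono2) auto
          also note \<open>S (2 * s) \<le> B\<close>
          finally have *: "(\<Sum>j<d. (e j)\<^sup>2) \<le> B" .
          have r: "real m / real d \<le> real m / real s" using d spos by (intro divide_left_mono) auto
          have "S m \<le> 4 * (real m / real d) * (\<Sum>j<d. (e j)\<^sup>2)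
               + 16 * real m * (real m / real d)\<^sup>2 * (e d)\<^sup>2"
            unfolding S_def using d s s2 by (intro scale_reduction tri nn) auto
          also have "\<dots> \<le> 4 * (real m / real s) * B + 16 * real m * (real m / real s)\<^sup>2 * (e d)\<^sup>2"
            using r * by (intro add_mono mult_mono mult_right_mono mult_left_mono power_mono)
              (auto intro: sum_nonneg)
          finally show ?thesis .
        qed
        define W where "W = (\<Sum>d=s..<2 * s. w d)"
        have Wc: "c * real s powr (-\<alpha>) \<le> W" unfolding W_def using s by (intro mass) auto
        have cs: "0 < c * real s powr (-\<alpha>)" using c spos by simp
        then have W0: "0 < W" using Wc by linarith
        have "W * S m = (\<Sum>d=s..<2 * s. w d * S m)" by (simp add: W_def sum_distrib_right)
        also have "\<dots> \<le> (\<Sum>d=s..<2 * s. w d * (4 * (real m / real s) * B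
            + 16 * real m * (real m / real s)\<^sup>2 * (e d)\<^sup>2))"
          by (intro sum_mono mult_left_mono each w) auto
        also have "\<dots> = W * (4 * (real m / real s) * B)
            + 16 * real m * (real m / real s)\<^sup>2 * (\<Sum>d=s..<2 * s. w d * (e d)\<^sup>2)"
          by (simp add: W_def sum_distrib_left sum_distrib_right sum.distrib distrib_left mult_ac
              flip: times_divide_eq_right)
        also have "\<dots> \<le> W * (4 * (real m / real s) * B) + 16 * real m * (real m / real s)\<^sup>2 * D"
        proof -
          have "(\<Sum>d=s..<2 * s. w d * (e d)\<^sup>2) \<le> D" unfolding D_def
            using s s2 less.prems w(1) by (intro sum_mono2) auto
          then show ?thesis by (intro add_left_mono mult_left_mono) auto
        qed
        finally have "S m \<le> 4 * (real m / real s) * B + 16 * real m * (real m / real s)\<^sup>2 * D / W"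
          using W0 by (subst mult_le_cancel_left_pos[OF W0, symmetric]) (simp add: distrib_left)
        also have "4 * (real m / real s) * B \<le> C / 2 * real m powr (1 + \<alpha>) * D"
        proof -
          \<comment> \<open>The loss m/s is compensated by one power of s in B. This is why the
            bound is stated with exponent 1 + \<alpha>: only the factor (2s/m)^\<alpha> remains, and
            it is small.\<close>
          have "4 * (real m / real s) * B = 8 * C * real m * real (2 * s) powr \<alpha> * D"
            unfolding B_def using spos by (simp add: powr_add field_simps)
          also have "\<dots> \<le> 8 * C * real m * ((2 / real R) powr \<alpha> * real m powr \<alpha>) * D"
          proof -
            have "real (2 * s) powr \<alpha> \<le> (2 / real R * real m) powr \<alpha>"
              using sR \<alpha> by (intro powr_mono2) auto
            then have "real (2 * s) powr \<alpha> \<le> (2 / real R) powr \<alpha> * real m powr \<alpha>"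
              by (simp add: powr_mult powr_divide)
            then show ?thesis using Cpos D0 by (intro mult_right_mono mult_left_mono) auto
          qed
          also have "\<dots> = 8 * (2 / real R) powr \<alpha> * (C * (real m * real m powr \<alpha>) * D)"
            by (simp add: mult_ac)
          also have "\<dots> \<le> 1 / 2 * (C * (real m * real m powr \<alpha>) * D)"
            using RR Cpos D0 by (intro mult_right_mono) auto
          finally show ?thesis using mpos by (simp add: powr_add)
        qed
        also have "16 * real m * (real m / real s)\<^sup>2 * D / W \<le> C / 2 * real m powr (1 + \<alpha>) * D"
        proof -
          have "16 * real m * (real m / real s)\<^sup>2 * D / W
              \<le> 16 * real m * (2 * real R)\<^sup>2 * D / (c * real s powr (-\<alpha>))"
            using ms Wc cs D0 by (intro frac_le mult_right_mono mult_left_mono power_mono mult_nonneg_nonneg) auto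
          also have "\<dots> = 64 * (real R)\<^sup>2 / c * (real m * real s powr \<alpha>) * D"
            using spos by (simp add: powr_minus power_mult_distrib field_simps)
          also have "\<dots> \<le> C / 2 * (real m * real m powr \<alpha>) * D"
            using C2 Cpos D0 \<alpha> s2 by (intro mult_right_mono mult_mono mult_left_mono powr_mono2) auto
          finally show ?thesis using mpos by (simp add: powr_add)
        qed
        finally show ?thesis by (simp add: mult_ac)
      qed
    qed
    then show ?thesis using m unfolding S_def D_def by blast
  qed
  then show ?thesis using Cpos by (intro exI[of _ C]) simp
qed

section \<open>The lower bound\<close>

lemma rate_summable_on: "transition_rate p \<Longrightarrow> p summable_on A"
  unfolding transition_rate_def using summable_on_subset_banach by blast

text \<open>The block mass is a difference of two tails, asymptotically (1 - 2^(-\<alpha>)) times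
  the limit constant times s^(-\<alpha>). Existence of the limit matters: two-sided power bounds on
  the tail would still allow empty dyadic blocks.\<close>

lemma DAN_dyadic_mass:
  assumes "p \<in> DAN \<alpha>" "0 < \<alpha>"
  obtains c s0 where "0 < c"
    "\<And>s. s0 \<le> s \<Longrightarrow> c * real s powr (-\<alpha>) \<le> (\<Sum>d=s..<2 * s. p (int d))"
proof -
  define T where "T x = (\<Sum>\<^sub>\<infinity>y\<in>{y. x \<le> real_of_int y}. p y)" for x :: real
  obtain c where c: "0 < c" and lim: "((\<lambda>x. x powr \<alpha> * T x) \<longlongrightarrow> c) at_top" and tr: "transition_rate p"
    using assms(1) unfolding DAN_def T_def by auto
  have lim2: "((\<lambda>x. (2 * x) powr \<alpha> * T (2 * x)) \<longlongrightarrow> c) at_top"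
    by (rule filterlim_compose[OF lim]) (rule filterlim_tendsto_pos_mult_at_top[OF tendsto_const], auto intro: filterlim_ident)
  define L where "L = c - 2 powr (-\<alpha>) * c"
  have "2 powr (-\<alpha>) < 1" using assms(2) by (simp add: powr_less_one)
  then have L: "0 < L" unfolding L_def using c by simp
  have "((\<lambda>x. x powr \<alpha> * T x - 2 powr (-\<alpha>) * ((2 * x) powr \<alpha> * T (2 * x))) \<longlongrightarrow> L) at_top"
    unfolding L_def by (intro tendsto_intros lim lim2)
  then have "\<forall>\<^sub>F x in at_top. L / 2 < x powr \<alpha> * T x - 2 powr (-\<alpha>) * ((2 * x) powr \<alpha> * T (2 * x))"
    using L by (intro order_tendstoD) auto
  then obtain x0 where x0: "\<And>x. x0 \<le> x \<Longrightarrow>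
      L / 2 < x powr \<alpha> * T x - 2 powr (-\<alpha>) * ((2 * x) powr \<alpha> * T (2 * x))"
    unfolding eventually_at_top_linorder by auto
  obtain s0 :: nat where s0: "max x0 1 \<le> real s0" using real_arch_simple by blast
  show ?thesis
  proof (rule that[of "L / 2" s0])
    fix s :: nat assume s: "s0 \<le> s"
    have sx: "x0 \<le> real s" "1 \<le> real s" using s s0 by auto
    have split: "{y. real s \<le> real_of_int y} = int ` {s..<2 * s} \<union> {y. 2 * real s \<le> real_of_int y}"
    proof -
      have "y \<in> int ` {s..<2 * s}" if "real s \<le> real_of_int y" "real_of_int y < 2 * real s" for y
        using that by (intro image_eqI[of _ _ "nat y"]) (auto simp: nat_less_iff le_nat_iff)
      then show ?thesis by fastforce
    qed
    have "T (real s) = infsum p (int ` {s..<2 * s}) + T (2 * real s)"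
      unfolding T_def split by (intro infsum_Un_disjoint rate_summable_on tr) auto
    also have "infsum p (int ` {s..<2 * s}) = (\<Sum>d=s..<2 * s. p (int d))"
      by (simp add: sum.reindex)
    finally have mass: "(\<Sum>d=s..<2 * s. p (int d)) = T (real s) - T (2 * real s)" by simp
    have "2 powr (-\<alpha>) * ((2 * real s) powr \<alpha> * T (2 * real s)) = real s powr \<alpha> * T (2 * real s)"
      by (simp add: powr_mult powr_minus field_simps)
    then have "L / 2 < real s powr \<alpha> * (T (real s) - T (2 * real s))"
      using x0[OF sx(1)] by (simp only: right_diff_distrib)
    then show "L / 2 * real s powr (-\<alpha>) \<le> (\<Sum>d=s..<2 * s. p (int d))"
      unfolding mass using sx(2) by (simp add: powr_minus field_simps)
  qed (use L in simp)
qed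

section \<open>Tail and second moment of the rate, for the upper bound\<close>

lemma DAN_tail_bound:
  assumes "p \<in> DAN \<alpha>" "0 < \<alpha>"
  obtains K where "0 < K"
    "\<And>a b. 1 \<le> a \<Longrightarrow> (\<Sum>d=a..b. p (int d)) \<le> K * real a powr (-\<alpha>)"
proof -
  define T where "T x = (\<Sum>\<^sub>\<infinity>y\<in>{y. x \<le> real_of_int y}. p y)" for x :: real
  obtain c where c: "0 < c" and lim: "((\<lambda>x. x powr \<alpha> * T x) \<longlongrightarrow> c) at_top" and tr: "transition_rate p"
    using assms(1) unfolding DAN_def T_def by auto
  have nn: "0 \<le> p z" for z using tr by (simp add: transition_rate_def)
  have "\<forall>\<^sub>F x in at_top. x powr \<alpha> * T x < c + 1"
    by (rule order_tendstoD[OF lim]) simp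
  then obtain x0 where x0: "\<And>x. x0 \<le> x \<Longrightarrow> x powr \<alpha> * T x < c + 1"
    unfolding eventually_at_top_linorder by auto
  have sub: "(\<Sum>d=a..b. p (int d)) \<le> infsum p A" if "int ` {a..b} \<subseteq> A" for a b A
  proof -
    have "(\<Sum>d=a..b. p (int d)) = sum p (int ` {a..b})" by (simp add: sum.reindex)
    also have "\<dots> \<le> infsum p A"
      using that nn by (intro finite_sum_le_infsum rate_summable_on tr) auto
    finally show ?thesis .
  qed
  have P0: "0 \<le> infsum p UNIV" using nn by (intro infsum_nonneg)
  define X where "X = max x0 1"
  \<comment> \<open>The limit covers a >= x0; below that, the total mass times X^\<alpha> is
    enough.\<close>
  define K where "K = c + 1 + X powr \<alpha> * infsum p UNIV"
  show ?thesis
  proof (rule that[of K])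
    show "0 < K" unfolding K_def using c P0 by (intro add_pos_nonneg mult_nonneg_nonneg) auto
  next
    fix a b :: nat assume a: "1 \<le> a"
    have "real a powr \<alpha> * (\<Sum>d=a..b. p (int d)) \<le> K"
    proof (cases "x0 \<le> real a")
      case True
      have "(\<Sum>d=a..b. p (int d)) \<le> T (real a)" unfolding T_def by (intro sub) auto
      then have "real a powr \<alpha> * (\<Sum>d=a..b. p (int d)) \<le> real a powr \<alpha> * T (real a)"
        by (intro mult_left_mono) auto
      also have "\<dots> \<le> c + 1" using x0[OF True] by simp
      also have "\<dots> \<le> K" unfolding K_def using P0 by simp
      finally show ?thesis .
    next
      case False
      have "real a powr \<alpha> * (\<Sum>d=a..b. p (int d)) \<le> X powr \<alpha> * infsum p UNIV"
        using False assms(2) nn unfolding X_def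
        by (intro mult_mono powr_mono2 sub sum_nonneg) auto
      also have "\<dots> \<le> K" unfolding K_def using c by simp
      finally show ?thesis .
    qed
    then show "(\<Sum>d=a..b. p (int d)) \<le> K * real a powr (-\<alpha>)"
      using a by (simp add: powr_minus field_simps)
  qed
qed

text \<open>The upper half of {1..M} contributes at most M^2 times a tail, which is of order
  M^(2-\<alpha>). Halving M multiplies this order by q = 2^(\<alpha>-2) < 1, since \<alpha> < 2, and
  K' is the sum of the resulting geometric series.\<close>

lemma DAN_second_moment_bound:
  assumes "p \<in> DAN \<alpha>" "0 < \<alpha>" "\<alpha> < 2"
  obtains K where "0 < K"
    "\<And>M. (\<Sum>d=1..M. p (int d) * (real d)\<^sup>2) \<le> K * real M powr (2 - \<alpha>)"
proof -
  obtain K where K: "0 < K" and tail: "\<And>a b. 1 \<le> a \<Longrightarrow> (\<Sum>d=a..b. p (int d)) \<le> K * real a powr (-\<alpha>)"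
    using DAN_tail_bound[OF assms(1,2)] by blast
  have nn: "0 \<le> p z" for z using assms(1) by (simp add: DAN_def transition_rate_def)
  define q where "q = (1/2::real) powr (2 - \<alpha>)"
  have "q = 2 powr (\<alpha> - 2)" unfolding q_def by (simp add: powr_divide powr_diff)
  then have q: "0 < q" "q < 1" using assms(3) by (auto intro: powr_less_one)
  define K' where "K' = K * 2 powr \<alpha> / (1 - q)"
  have K': "0 < K'" "K * 2 powr \<alpha> = K' * (1 - q)" unfolding K'_def using K q by auto
  have "(\<Sum>d=1..M. p (int d) * (real d)\<^sup>2) \<le> K' * real M powr (2 - \<alpha>)" for M
  proof (induction M rule: less_induct)
    case (less M)
    show ?case
    proof (cases "M = 0")
      case False
      define h where "h = M div 2"
      have h: "h < M" "real h \<le> real M / 2" "real M / 2 \<le> real (h + 1)" using False unfolding h_def by linarith+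
      have "{1..M} = {1..h} \<union> {h + 1..M}" using h by auto
      then have "(\<Sum>d=1..M. p (int d) * (real d)\<^sup>2)
          = (\<Sum>d=1..h. p (int d) * (real d)\<^sup>2) + (\<Sum>d=h+1..M. p (int d) * (real d)\<^sup>2)"
        by (simp add: sum.union_disjoint)
      also have "(\<Sum>d=1..h. p (int d) * (real d)\<^sup>2) \<le> K' * real h powr (2 - \<alpha>)"
        by (rule less.IH[OF h(1)])
      also have "\<dots> \<le> K' * (1 / 2 * real M) powr (2 - \<alpha>)"
        using h K' assms(3) by (intro mult_left_mono powr_mono2) auto
      also have "\<dots> = K' * (q * real M powr (2 - \<alpha>))"
        unfolding q_def by (simp only: powr_mult)
      also have "(\<Sum>d=h+1..M. p (int d) * (real d)\<^sup>2) \<le> (\<Sum>d=h+1..M. p (int d) * (real M)\<^sup>2)"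
        using nn by (intro sum_mono mult_left_mono power_mono) auto
      also have "\<dots> \<le> K * real (h + 1) powr (-\<alpha>) * (real M)\<^sup>2"
        unfolding sum_distrib_right[symmetric] by (intro mult_right_mono tail) auto
      also have "\<dots> \<le> K * (real M / 2) powr (-\<alpha>) * (real M)\<^sup>2"
        using h K False assms(2) by (intro mult_right_mono mult_left_mono powr_mono2') auto
      also have "\<dots> = K * 2 powr \<alpha> * real M powr (2 - \<alpha>)"
        using False by (simp add: powr_divide powr_minus powr_diff field_simps)
      finally show ?thesis using K'(2) by (simp add: algebra_simps)
    qed simp
  qed
  then show ?thesis using that K' by blast
qed

lemma gap_ex_lower_bound:
  assumes "p \<in> DAN \<alpha>" "0 < p 1" "0 < \<alpha>"
  obtains \<kappa> where "0 < \<kappa>"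
    "\<And>n l. 1 \<le> n \<Longrightarrow> l \<le> 2 * n + 1 \<Longrightarrow> ereal (\<kappa> * real (2 * n + 1) powr (-\<alpha>)) \<le> gap_ex p n l"
proof -
  have nn: "0 \<le> p z" for z using assms(1) by (simp add: DAN_def transition_rate_def)
  have sym: "symmetric_rate p" using assms(1) by (simp add: DAN_def)
  obtain c s0 where c: "0 < c" "\<And>s. s0 \<le> s \<Longrightarrow> c * real s powr (-\<alpha>) \<le> (\<Sum>d=s..<2 * s. p (int d))"
    using DAN_dyadic_mass[OF assms(1,3)] by blast
  have p1: "0 < p (int 1)" using assms(2) by simp
  obtain C where C: "0 < C" and multi: "\<forall>e M m. (\<forall>s t. e (s + t) \<le> 2 * e s + e t) \<longrightarrow>
      (\<forall>t. 0 \<le> e t) \<longrightarrow> e 0 = 0 \<longrightarrow> 1 \<le> m \<longrightarrow> m \<le> M \<longrightarrow>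
      (\<Sum>t\<le>m. (e t)\<^sup>2) \<le> C * real m powr (1 + \<alpha>) * (\<Sum>d=1..M. p (int d) * (e d)\<^sup>2)"
    using multiscale_bound[of \<alpha> "\<lambda>d. p (int d)" c s0, OF assms(3) nn p1 c] by blast
  show ?thesis
  \<comment> \<open>The numerical constants cancel: 4 from the complete graph against 2 from ordered
    pairs and 2 from the Dirichlet form. On a one-point level the infimum is over the empty set and
    the bound is trivial.\<close>
  proof (rule that[of "1 / C"])
    show "0 < 1 / C" using C by simp
    fix n l :: nat assume n: "1 \<le> n" and l: "l \<le> 2 * n + 1"
    define N where "N = real (2 * n + 1)"
    have N: "0 < N" unfolding N_def by simp
    have "1 / C * N powr (-\<alpha>) \<le> \<theta>"
      if "\<theta> \<noteq> 0" and ev: "eigenvalue_on (\<Omega>_ex_level n l) (\<lambda>f s. - L_ex p n f s) \<theta>" for \<theta>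
    proof -
      obtain f where f: "\<exists>\<eta>\<in>level (box n) l. f \<eta> \<noteq> 0"
        and eq: "\<And>\<eta>. \<eta> \<in> level (box n) l \<Longrightarrow> - L_ex p n f \<eta> = \<theta> * f \<eta>"
        using ev unfolding eigenvalue_on_def \<Omega>_ex_level_eq by blast
      define F where "F = (\<Sum>\<eta>\<in>level (box n) l. (f \<eta>)\<^sup>2)"
      define P where "P = (\<Sum>t=1..2*n. p (int t) * shift_energy (box n) l f t)"
      have F: "0 < F"
      proof -
        obtain \<eta> where \<eta>: "\<eta> \<in> level (box n) l" "f \<eta> \<noteq> 0" using f by blast
        then show ?thesis unfolding F_def
          by (intro sum_pos2[OF finite_level[OF finite_box] \<eta>(1)]) auto
      qed
      have "\<theta> * (\<Sum>\<eta>\<in>level (box n) l. f \<eta>) = - (\<Sum>\<eta>\<in>level (box n) l. L_ex p n f \<eta>)"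
        by (simp add: sum_distrib_left flip: eq sum_negf)
      then have mean: "(\<Sum>\<eta>\<in>level (box n) l. f \<eta>) = 0"
        using sum_L_ex[OF sym] \<open>\<theta> \<noteq> 0\<close> by simp
      have D: "\<theta> * F = P / 2"
      proof -
        have "\<theta> * F = (\<Sum>\<eta>\<in>level (box n) l. f \<eta> * - L_ex p n f \<eta>)"
          unfolding F_def sum_distrib_left by (intro sum.cong refl) (simp add: eq power2_eq_square)
        then show ?thesis unfolding dirichlet_form[OF sym] P_def .
      qed
      have "0 \<le> P" unfolding P_def by (intro sum_nonneg mult_nonneg_nonneg nn shift_energy_nonneg)
      then have \<theta>: "0 \<le> \<theta>" using D F mult_neg_pos[of \<theta> F] by (cases "\<theta> < 0") auto
      have "4 * N * F \<le> (\<Sum>x\<in>box n. \<Sum>y\<in>box n. 1 * swap_energy (box n) l f x y)"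
        using complete_graph_poincare[OF finite_box _ mean] l by (simp add: card_box N_def F_def)
      also have "\<dots> = 2 * (\<Sum>t=1..2*n. shift_energy (box n) l f t)"
        unfolding box_def using sum_even_weight_swap_energy[of "\<lambda>_. 1" "int n" "- int n" "2 * n" l f]
        by simp
      also have "(\<Sum>t=1..2*n. shift_energy (box n) l f t) \<le> (\<Sum>t\<le>2*n. (sqrt (shift_energy (box n) l f t))\<^sup>2)"
        by (simp add: shift_energy_nonneg) (intro sum_mono2 shift_energy_nonneg, auto)
      also have "\<dots> \<le> C * real (2 * n) powr (1 + \<alpha>) *
          (\<Sum>t=1..2*n. p (int t) * (sqrt (shift_energy (box n) l f t))\<^sup>2)"
        by (rule multi[rule_format]) (use n in \<open>auto simp: box_def shift_energy_nonneg intro: sqrt_shift_energy_add\<close>)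
      also have "\<dots> = C * real (2 * n) powr (1 + \<alpha>) * (2 * (\<theta> * F))"
        unfolding D P_def by (simp add: shift_energy_nonneg)
      also have "\<dots> \<le> C * N powr (1 + \<alpha>) * (2 * (\<theta> * F))"
        using C \<theta> F assms(3) unfolding N_def by (intro mult_right_mono mult_left_mono powr_mono2) auto
      finally have "F * N \<le> F * (C * N powr (1 + \<alpha>) * \<theta>)" by (simp add: mult_ac)
      then have "N \<le> C * N powr (1 + \<alpha>) * \<theta>" using F by simp
      then have "N * 1 \<le> N * (C * N powr \<alpha> * \<theta>)" using N by (simp add: powr_add mult_ac)
      then have "1 \<le> C * N powr \<alpha> * \<theta>" using N by (simp only: mult_le_cancel_left_pos)
      then show ?thesis using N C by (simp add: powr_minus field_simps)
    qed
    then show "ereal (1 / C * real (2 * n + 1) powr (-\<alpha>)) \<le> gap_ex p n l"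
      unfolding gap_ex_def spectral_gap_def N_def by (intro INF_greatest) auto
  qed
qed

section \<open>Eigenfunctions of a finite weighted graph\<close>

lemma linear_coefficient_0:
  fixes \<beta> \<gamma> :: real
  assumes "\<And>t. 0 \<le> 2 * t * \<beta> + t\<^sup>2 * \<gamma>"
  shows "\<beta> = 0"
proof (rule ccontr)
  assume \<beta>: "\<beta> \<noteq> 0"
  define g where "g = \<bar>\<gamma>\<bar> + 1"
  have g: "0 < g" "\<gamma> \<le> g" unfolding g_def by auto
  \<comment> \<open>This t minimises the quadratic with \<gamma> replaced by the positive majorant
    g.\<close>
  have "0 \<le> 2 * (- \<beta> / g) * \<beta> + (- \<beta> / g)\<^sup>2 * \<gamma>" by (rule assms)
  also have "\<dots> \<le> 2 * (- \<beta> / g) * \<beta> + (- \<beta> / g)\<^sup>2 * g"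
    using g by (intro add_left_mono mult_left_mono) auto
  also have "\<dots> = - (\<beta>\<^sup>2 / g)" using g by (simp add: power2_eq_square field_simps)
  finally have "\<beta>\<^sup>2 / g \<le> 0" by simp
  then show False using g \<beta> by (simp add: divide_le_0_iff)
qed

text \<open>Pinning the coordinates outside V to 0 makes Tychonoff's theorem apply directly in the
  function space.\<close>

lemma compact_cube: "compact {a :: 'a \<Rightarrow> real. \<forall>x. a x \<in> (if x \<in> V then {-1..1} else {0})}"
proof -
  let ?S = "\<lambda>x. if x \<in> V then {-1..1 :: real} else {0}"
  have "compactin (product_topology (\<lambda>_. euclidean) UNIV) (PiE UNIV ?S)"
    unfolding compactin_PiE by simp
  then have "compact (PiE UNIV ?S)" by (simp add: euclidean_product_topology)
  then show ?thesis by (simp add: PiE_UNIV_domain Pi_def)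
qed

text \<open>Ordered pairs are summed, so for symmetric c this is twice the Dirichlet form of the
  walk with rates c. The factor returns in the eigenvalue equation below and in the eigenvalue m / 2
  of the walk.\<close>

definition graph_energy :: "'a set \<Rightarrow> ('a \<Rightarrow> 'a \<Rightarrow> real) \<Rightarrow> ('a \<Rightarrow> real) \<Rightarrow> real" where
  "graph_energy V c b = (\<Sum>x\<in>V. \<Sum>y\<in>V. c x y * (b x - b y)\<^sup>2)"

text \<open>The energy is continuous on the compact set of normalised mean-zero functions, and
  degree-two homogeneity extends the bound to all mean-zero functions. The points u and v supply a
  non-zero mean-zero function.\<close>

lemma graph_energy_minimizer:
  fixes c :: "'a \<Rightarrow> 'a \<Rightarrow> real"
  assumes V: "finite V" and uv: "u \<in> V" "v \<in> V" "u \<noteq> v"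
  obtains a where "(\<Sum>x\<in>V. a x) = 0" "(\<Sum>x\<in>V. (a x)\<^sup>2) = 1"
    "\<And>b. (\<Sum>x\<in>V. b x) = 0 \<Longrightarrow> graph_energy V c a * (\<Sum>x\<in>V. (b x)\<^sup>2) \<le> graph_energy V c b"
proof -
  let ?C = "{a :: 'a \<Rightarrow> real. \<forall>x. a x \<in> (if x \<in> V then {-1..1} else {0})}"
  define K where "K = ?C \<inter> ({a. (\<Sum>x\<in>V. a x) = 0} \<inter> {a. (\<Sum>x\<in>V. (a x)\<^sup>2) = 1})"
  have K: "compact K" unfolding K_def
    by (intro compact_Int_closed compact_cube closed_Int closed_Collect_eq continuous_intros
        continuous_on_product_coordinates)
  have normalize: "(\<lambda>x. if x \<in> V then b x / sqrt (\<Sum>x\<in>V. (b x)\<^sup>2) else 0) \<in> K"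
    if b: "(\<Sum>x\<in>V. b x) = 0" "0 < (\<Sum>x\<in>V. (b x)\<^sup>2)" for b :: "'a \<Rightarrow> real"
  proof -
    let ?s = "sqrt (\<Sum>x\<in>V. (b x)\<^sup>2)"
    have "b x / ?s \<in> {-1..1}" if "x \<in> V" for x
    proof -
      have "(b x)\<^sup>2 \<le> (\<Sum>x\<in>V. (b x)\<^sup>2)" using V that by (intro member_le_sum) auto
      then have "\<bar>b x\<bar> \<le> ?s" by (simp add: real_le_rsqrt)
      then have "\<bar>b x / ?s\<bar> \<le> 1" using b(2) by (simp add: abs_divide divide_le_eq)
      then show ?thesis by (meson abs_le_iff atLeastAtMost_iff minus_le_iff)
    qed
    moreover have "(\<Sum>x\<in>V. b x / ?s) = 0" using b(1) by (simp flip: sum_divide_distrib)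
    moreover have "(\<Sum>x\<in>V. (b x / ?s)\<^sup>2) = 1"
      using b(2) by (simp add: power_divide flip: sum_divide_distrib)
    ultimately show ?thesis unfolding K_def by simp
  qed
  have "K \<noteq> {}"
  proof -
    define b where "b x = (if x = u then 1 else 0) - (if x = v then 1 else 0 :: real)" for x
    have "(\<Sum>x\<in>V. b x) = 0" using V uv by (simp add: b_def sum_subtractf)
    moreover have "0 < (\<Sum>x\<in>V. (b x)\<^sup>2)"
      using uv by (intro sum_pos2[OF V uv(1)]) (auto simp: b_def)
    ultimately show ?thesis using normalize by blast
  qed
  moreover have "continuous_on K (graph_energy V c)" unfolding graph_energy_def
    by (intro continuous_intros continuous_on_product_then_coordinatewise[OF continuous_on_id])
  ultimately obtain a where a: "a \<in> K" "\<And>b. b \<in> K \<Longrightarrow> graph_energy V c a \<le> graph_energy V c b"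
    using continuous_attains_inf[OF K] by metis
  show ?thesis
  proof (rule that)
    show "(\<Sum>x\<in>V. a x) = 0" "(\<Sum>x\<in>V. (a x)\<^sup>2) = 1" using a(1) by (auto simp: K_def)
    fix b :: "'a \<Rightarrow> real" assume b: "(\<Sum>x\<in>V. b x) = 0"
    define s where "s = (\<Sum>x\<in>V. (b x)\<^sup>2)"
    show "graph_energy V c a * s \<le> graph_energy V c b"
    proof (cases "s = 0")
      case True
      then have "b x = 0" if "x \<in> V" for x
        using V that by (simp add: s_def sum_nonneg_eq_0_iff)
      then show ?thesis using True by (simp add: graph_energy_def)
    next
      case False
      then have s: "0 < s" unfolding s_def using sum_nonneg[of V "\<lambda>x. (b x)\<^sup>2"] by simp
      have "graph_energy V c a \<le> graph_energy V c (\<lambda>x. if x \<in> V then b x / sqrt s else 0)"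
        unfolding s_def using s by (intro a normalize b) (simp add: s_def)
      also have "\<dots> = (\<Sum>x\<in>V. \<Sum>y\<in>V. c x y * (b x - b y)\<^sup>2 / s)"
        unfolding graph_energy_def using s
        by (intro sum.cong refl) (simp add: power_divide flip: diff_divide_distrib)
      also have "\<dots> = graph_energy V c b / s"
        by (simp add: graph_energy_def sum_divide_distrib)
      finally show ?thesis using s by (simp add: pos_le_divide_eq)
    qed
  qed
qed

lemma graph_eigenfunction:
  fixes c :: "'a \<Rightarrow> 'a \<Rightarrow> real"
  assumes V: "finite V" and uv: "u \<in> V" "v \<in> V" "u \<noteq> v" and sym: "\<And>x y. c x y = c y x"
  obtains a m where "(\<Sum>x\<in>V. a x) = 0" "(\<Sum>x\<in>V. (a x)\<^sup>2) = 1" "m = graph_energy V c a"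
    "\<And>b. (\<Sum>x\<in>V. b x) = 0 \<Longrightarrow> m * (\<Sum>x\<in>V. (b x)\<^sup>2) \<le> graph_energy V c b"
    "\<And>x. x \<in> V \<Longrightarrow> 2 * (\<Sum>y\<in>V. c x y * (a x - a y)) = m * a x"
proof -
  obtain a where a: "(\<Sum>x\<in>V. a x) = 0" "(\<Sum>x\<in>V. (a x)\<^sup>2) = 1"
    and min: "\<And>b. (\<Sum>x\<in>V. b x) = 0 \<Longrightarrow> graph_energy V c a * (\<Sum>x\<in>V. (b x)\<^sup>2) \<le> graph_energy V c b"
    using graph_energy_minimizer[OF V uv] by blast
  define m where "m = graph_energy V c a"
  define r where "r x = 2 * (\<Sum>y\<in>V. c x y * (a x - a y))" for x
  have bilinear: "(\<Sum>x\<in>V. \<Sum>y\<in>V. c x y * ((a x - a y) * (b x - b y))) = (\<Sum>x\<in>V. b x * r x)" for b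
  proof -
    let ?X = "\<Sum>x\<in>V. \<Sum>y\<in>V. b x * (c x y * (a x - a y))"
    have "(\<Sum>x\<in>V. \<Sum>y\<in>V. b y * (c x y * (a x - a y))) = (\<Sum>x\<in>V. \<Sum>y\<in>V. b x * (c y x * (a y - a x)))"
      by (rule sum.swap)
    also have "\<dots> = (\<Sum>x\<in>V. \<Sum>y\<in>V. - (b x * (c x y * (a x - a y))))"
      by (intro sum.cong refl) (simp add: sym[of _ "_ :: 'a"] algebra_simps)
    also have "\<dots> = - ?X" by (simp add: sum_negf)
    finally have "(\<Sum>x\<in>V. \<Sum>y\<in>V. b y * (c x y * (a x - a y))) = - ?X" .
    moreover have "(\<Sum>x\<in>V. \<Sum>y\<in>V. c x y * ((a x - a y) * (b x - b y)))
        = ?X - (\<Sum>x\<in>V. \<Sum>y\<in>V. b y * (c x y * (a x - a y)))"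
      by (simp add: algebra_simps flip: sum_subtractf)
    ultimately have "(\<Sum>x\<in>V. \<Sum>y\<in>V. c x y * ((a x - a y) * (b x - b y))) = 2 * ?X" by simp
    then show ?thesis by (simp add: r_def sum_distrib_left mult_ac)
  qed
  have sum_r: "(\<Sum>x\<in>V. r x) = 0" using bilinear[of "\<lambda>_. 1"] by simp
  \<comment> \<open>The residual of the eigenvalue equation is itself an admissible direction of
    mean zero. The first variation of the energy along it is a multiple of its squared norm, so
    minimality makes it vanish.\<close>
  define b where "b x = r x - m * a x" for x
  have mean: "(\<Sum>x\<in>V. b x) = 0" by (simp add: b_def sum_subtractf sum_r a flip: sum_distrib_left)
  have "0 \<le> 2 * t * ((\<Sum>x\<in>V. b x * r x) - m * (\<Sum>x\<in>V. a x * b x))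
      + t\<^sup>2 * (graph_energy V c b - m * (\<Sum>x\<in>V. (b x)\<^sup>2))" for t
  proof -
    have "graph_energy V c (\<lambda>x. a x + t * b x)
        = (\<Sum>x\<in>V. \<Sum>y\<in>V. c x y * (a x - a y)\<^sup>2 + 2 * t * (c x y * ((a x - a y) * (b x - b y)))
          + t\<^sup>2 * (c x y * (b x - b y)\<^sup>2))"
      unfolding graph_energy_def by (intro sum.cong refl) (simp add: power2_eq_square algebra_simps)
    also have "\<dots> = m + 2 * t * (\<Sum>x\<in>V. b x * r x) + t\<^sup>2 * graph_energy V c b"
      unfolding m_def graph_energy_def by (simp add: sum.distrib bilinear flip: sum_distrib_left)
    finally have 1: "graph_energy V c (\<lambda>x. a x + t * b x)
        = m + 2 * t * (\<Sum>x\<in>V. b x * r x) + t\<^sup>2 * graph_energy V c b" .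
    have "(\<Sum>x\<in>V. (a x + t * b x)\<^sup>2) = (\<Sum>x\<in>V. (a x)\<^sup>2 + 2 * t * (a x * b x) + t\<^sup>2 * (b x)\<^sup>2)"
      by (intro sum.cong refl) (simp add: power2_eq_square algebra_simps)
    also have "\<dots> = 1 + 2 * t * (\<Sum>x\<in>V. a x * b x) + t\<^sup>2 * (\<Sum>x\<in>V. (b x)\<^sup>2)"
      by (simp add: sum.distrib a flip: sum_distrib_left)
    finally have 2: "(\<Sum>x\<in>V. (a x + t * b x)\<^sup>2) = 1 + 2 * t * (\<Sum>x\<in>V. a x * b x) + t\<^sup>2 * (\<Sum>x\<in>V. (b x)\<^sup>2)" .
    have "(\<Sum>x\<in>V. a x + t * b x) = 0" by (simp add: sum.distrib a mean flip: sum_distrib_left)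
    from min[OF this] show ?thesis unfolding 1 2 m_def[symmetric] by (simp add: algebra_simps)
  qed
  then have "(\<Sum>x\<in>V. b x * r x) - m * (\<Sum>x\<in>V. a x * b x) = 0" by (rule linear_coefficient_0)
  moreover have "b x * b x = b x * r x - m * (a x * b x)" for x
    by (simp add: b_def algebra_simps)
  ultimately have "(\<Sum>x\<in>V. b x * b x) = 0" by (simp add: sum_subtractf sum_distrib_left)
  then have "b x = 0" if "x \<in> V" for x
    using V that by (simp add: sum_nonneg_eq_0_iff)
  then show ?thesis using that[OF a m_def, folded m_def] min a unfolding b_def r_def m_def by auto
qed

section \<open>The upper bound\<close>

definition linear_statistic :: "int set \<Rightarrow> (int \<Rightarrow> real) \<Rightarrow> (int \<Rightarrow> nat) \<Rightarrow> real" where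
  "linear_statistic V a \<eta> = (\<Sum>z\<in>V. a z * real (\<eta> z))"

lemma linear_statistic_exchange:
  assumes "finite V" "x \<in> V" "y \<in> V"
  shows "linear_statistic V a (exchange \<eta> x y) - linear_statistic V a \<eta>
    = (a x - a y) * (real (\<eta> y) - real (\<eta> x))"
proof (cases "x = y")
  case True
  then show ?thesis by (simp add: exchange_def)
next
  case False
  have "linear_statistic V a (exchange \<eta> x y) - linear_statistic V a \<eta>
      = (\<Sum>z\<in>V. a z * (real (exchange \<eta> x y z) - real (\<eta> z)))"
    by (simp add: linear_statistic_def sum_subtractf right_diff_distrib)
  also have "\<dots> = (\<Sum>z\<in>{x, y}. a z * (real (exchange \<eta> x y z) - real (\<eta> z)))"
    using assms by (intro sum.mono_neutral_right) (auto simp: exchange_def)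
  also have "\<dots> = (a x - a y) * (real (\<eta> y) - real (\<eta> x))"
    using False by (simp add: exchange_def algebra_simps)
  finally show ?thesis .
qed

text \<open>After symmetrisation the generator is linear in \<eta> on linear statistics, and moving
  it to the coefficients yields the one-particle walk.\<close>

lemma L_ex_linear_statistic:
  assumes p: "symmetric_rate p" and \<eta>: "\<eta> \<in> level (box n) l"
    and a: "\<And>x. x \<in> box n \<Longrightarrow> 2 * (\<Sum>y\<in>box n. p (y - x) * (a x - a y)) = m * a x"
  shows "- L_ex p n (linear_statistic (box n) a) \<eta> = m / 2 * linear_statistic (box n) a \<eta>"
proof -
  have p': "p (x - y) = p (y - x)" for x y
    using p unfolding symmetric_rate_def by (metis minus_diff_eq)
  let ?X = "\<Sum>x\<in>box n. \<Sum>y\<in>box n. real (\<eta> x) * (p (y - x) * (a x - a y))"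
  have "(\<Sum>x\<in>box n. \<Sum>y\<in>box n. real (\<eta> y) * (p (y - x) * (a x - a y)))
      = (\<Sum>x\<in>box n. \<Sum>y\<in>box n. real (\<eta> x) * (p (x - y) * (a y - a x)))"
    by (rule sum.swap)
  also have "\<dots> = (\<Sum>x\<in>box n. \<Sum>y\<in>box n. - (real (\<eta> x) * (p (y - x) * (a x - a y))))"
    by (intro sum.cong refl) (subst p', simp add: algebra_simps)
  also have "\<dots> = - ?X" by (simp add: sum_negf)
  finally have swap: "(\<Sum>x\<in>box n. \<Sum>y\<in>box n. real (\<eta> y) * (p (y - x) * (a x - a y))) = - ?X" .
  have "2 * L_ex p n (linear_statistic (box n) a) \<eta>
      = (\<Sum>x\<in>box n. \<Sum>y\<in>box n. p (y - x) * ((a x - a y) * (real (\<eta> y) - real (\<eta> x))))"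
    by (simp add: L_ex_symmetric[OF p \<eta>] linear_statistic_exchange[OF finite_box])
  also have "\<dots> = (\<Sum>x\<in>box n. \<Sum>y\<in>box n. real (\<eta> y) * (p (y - x) * (a x - a y))) - ?X"
    by (simp add: algebra_simps flip: sum_subtractf)
  also have "\<dots> = - (2 * ?X)" unfolding swap by simp
  also have "2 * ?X = (\<Sum>x\<in>box n. real (\<eta> x) * (2 * (\<Sum>y\<in>box n. p (y - x) * (a x - a y))))"
    by (simp add: sum_distrib_left mult_ac)
  also have "\<dots> = (\<Sum>x\<in>box n. real (\<eta> x) * (m * a x))"
    by (intro sum.cong refl) (simp only: a)
  also have "\<dots> = m * linear_statistic (box n) a \<eta>"
    by (simp add: linear_statistic_def sum_distrib_left mult_ac)
  finally show ?thesis by simp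
qed

text \<open>Put a particle at x and none at y, which is possible for 0 < l < card V. Swapping the
  two sites changes the statistic, so it cannot vanish both before and after.\<close>

lemma linear_statistic_nonzero:
  assumes "finite V" "x \<in> V" "y \<in> V" "a x \<noteq> a y" "0 < l" "l < card V"
  obtains \<eta> where "\<eta> \<in> level V l" "linear_statistic V a \<eta> \<noteq> 0"
proof -
  have "x \<noteq> y" using assms by auto
  have "card (V - {x, y}) = card V - 2" using assms \<open>x \<noteq> y\<close> by (simp add: card_Diff_subset)
  then have "l - 1 \<le> card (V - {x, y})" using assms by linarith
  then obtain A where A: "A \<subseteq> V - {x, y}" "card A = l - 1" "finite A"
    by (rule obtain_subset_with_card_n)
  define \<eta> :: "int \<Rightarrow> nat" where "\<eta> = restrict (\<lambda>z. if z \<in> insert x A then 1 else 0) V"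
  have "sum \<eta> V = (\<Sum>z\<in>V. if z \<in> insert x A then 1 else 0)"
    by (intro sum.cong) (auto simp: \<eta>_def)
  also have "\<dots> = card (V \<inter> insert x A)" using assms(1) by (simp add: sum.If_cases Int_def)
  also have "V \<inter> insert x A = insert x A" using A assms(2) by auto
  also have "card (insert x A) = l" using A assms(5) by (subst card_insert_disjoint) auto
  finally have \<eta>: "\<eta> \<in> level V l" unfolding level_def \<eta>_def by auto
  have "\<eta> x = 1" "\<eta> y = 0" using A assms(2,3) \<open>x \<noteq> y\<close> by (auto simp: \<eta>_def)
  then have "linear_statistic V a (exchange \<eta> x y) \<noteq> linear_statistic V a \<eta>"
    using linear_statistic_exchange[OF assms(1-3), of a \<eta>] assms(4) by auto
  then show ?thesis
    using that[OF \<eta>] that[OF exchange_in_level[OF assms(1) \<eta> assms(2,3)]] by metis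
qed

lemma gap_ex_le_rayleigh:
  assumes tr: "transition_rate p" and p: "symmetric_rate p" "0 < p 1" and n: "1 \<le> n"
    and l: "0 < l" "l < 2 * n + 1"
    and b: "(\<Sum>x\<in>box n. b x) = 0" "0 < (\<Sum>x\<in>box n. (b x)\<^sup>2)"
  shows "gap_ex p n l \<le> ereal (graph_energy (box n) (\<lambda>x y. p (y - x)) b / (2 * (\<Sum>x\<in>box n. (b x)\<^sup>2)))"
proof -
  let ?V = "box n" and ?c = "\<lambda>x y. p (y - x)"
  have nn: "0 \<le> p z" for z using tr by (simp add: transition_rate_def)
  have p': "p (y - x) = p (x - y)" for x y
    using p unfolding symmetric_rate_def by (metis minus_diff_eq)
  have "0 \<in> ?V" "1 \<in> ?V" using n by (auto simp: box_def)
  then obtain a m where a: "(\<Sum>x\<in>?V. a x) = 0" "(\<Sum>x\<in>?V. (a x)\<^sup>2) = 1" "m = graph_energy ?V ?c a"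
    and min: "\<And>b. (\<Sum>x\<in>?V. b x) = 0 \<Longrightarrow> m * (\<Sum>x\<in>?V. (b x)\<^sup>2) \<le> graph_energy ?V ?c b"
    and eig: "\<And>x. x \<in> ?V \<Longrightarrow> 2 * (\<Sum>y\<in>?V. ?c x y * (a x - a y)) = m * a x"
    using graph_eigenfunction[OF finite_box, of 0 n 1 ?c] p' by auto
  have nonconst: "\<exists>x\<in>?V. \<exists>y\<in>?V. a x \<noteq> a y"
  proof (rule ccontr)
    assume "\<not> ?thesis"
    then have "a x = a 0" if "x \<in> ?V" for x using that \<open>0 \<in> ?V\<close> by blast
    then have eq: "(\<Sum>x\<in>?V. a x) = (\<Sum>x\<in>?V. a 0)" "(\<Sum>x\<in>?V. (a x)\<^sup>2) = (\<Sum>x\<in>?V. (a 0)\<^sup>2)"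
      by (auto intro!: sum.cong)
    show False using a(1,2) unfolding eq by (auto simp: card_box)
  qed
  \<comment> \<open>Zero energy and p(1) > 0 make a equal at neighbouring sites, hence constant on
    the box, against \<open>nonconst\<close>.\<close>
  have "m \<noteq> 0"
  proof
    assume "m = 0"
    have "p (y - x) * (a x - a y)\<^sup>2 = 0" if "x \<in> ?V" "y \<in> ?V" for x y
    proof -
      have "(\<Sum>x\<in>?V. \<Sum>y\<in>?V. p (y - x) * (a x - a y)\<^sup>2) = 0"
        using a(3) \<open>m = 0\<close> by (simp add: graph_energy_def)
      then have "(\<Sum>y\<in>?V. p (y - x) * (a x - a y)\<^sup>2) = 0"
        using that finite_box nn by (subst (asm) sum_nonneg_eq_0_iff) (auto intro!: sum_nonneg)
      then show ?thesis
        using that finite_box nn by (subst (asm) sum_nonneg_eq_0_iff) auto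
    qed
    then have step: "a (x + 1) = a x" if "x \<in> ?V" "x + 1 \<in> ?V" for x
      using that p(2) by (metis add_diff_cancel_left' eq_iff_diff_eq_0 less_irrefl mult_eq_0_iff power_eq_0_iff)
    have const: "k \<le> 2 * n \<Longrightarrow> a (- int n + int k) = a (- int n)" for k
    proof (induction k)
      case (Suc k)
      then show ?case using step[of "- int n + int k"] by (simp add: box_def algebra_simps)
    qed simp
    have "a x = a (- int n)" if "x \<in> ?V" for x
      using const[of "nat (x + int n)"] that by (simp add: box_def nat_le_iff)
    with nonconst show False by metis
  qed
  obtain x y where xy: "x \<in> ?V" "y \<in> ?V" "a x \<noteq> a y" using nonconst by blast
  obtain \<eta> where \<eta>: "\<eta> \<in> level ?V l" "linear_statistic ?V a \<eta> \<noteq> 0"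
    using linear_statistic_nonzero[OF finite_box xy l(1)] l(2) by (auto simp: card_box)
  have "eigenvalue_on (\<Omega>_ex_level n l) (\<lambda>f s. - L_ex p n f s) (m / 2)"
    unfolding eigenvalue_on_def \<Omega>_ex_level_eq
    using \<eta> L_ex_linear_statistic[OF p(1) _ eig] by blast
  then have "gap_ex p n l \<le> ereal (m / 2)"
    unfolding gap_ex_def spectral_gap_def using \<open>m \<noteq> 0\<close> by (intro INF_lower) simp
  also have "m / 2 \<le> graph_energy ?V ?c b / (2 * (\<Sum>x\<in>?V. (b x)\<^sup>2))"
    using min[OF b(1)] b(2) by (simp add: field_simps)
  finally show ?thesis by simp
qed

lemma sum_box_id: "(\<Sum>x\<in>box n. real_of_int x) = 0"
proof -
  have "(\<Sum>x\<in>box n. real_of_int x) = (\<Sum>x\<in>box n. - real_of_int x)"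
    by (rule sum.reindex_bij_witness[where i=uminus and j=uminus]) (auto simp: box_def)
  then show ?thesis by (simp add: sum_negf)
qed

lemma sum_box_squares: "(\<Sum>x\<in>box n. (real_of_int x)\<^sup>2) = real n * (real n + 1) * (2 * real n + 1) / 3"
proof (induction n)
  case (Suc n)
  have "box (Suc n) = insert (- int (Suc n)) (insert (int (Suc n)) (box n))"
    by (auto simp: box_def)
  then have "(\<Sum>x\<in>box (Suc n). (real_of_int x)\<^sup>2) = 2 * (real n + 1)\<^sup>2 + (\<Sum>x\<in>box n. (real_of_int x)\<^sup>2)"
    by (simp add: finite_box) (simp add: box_def power2_eq_square algebra_simps)
  then show ?case unfolding Suc by (simp add: power2_eq_square field_simps)
qed (simp add: box_def)

text \<open>From any x the displacements lie in [-2n, 2n]; extending the sum to all of them removes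
  the dependence on x.\<close>

lemma identity_energy_le:
  assumes "symmetric_rate p" and nn: "\<And>z. 0 \<le> p z"
  shows "graph_energy (box n) (\<lambda>x y. p (y - x)) real_of_int
    \<le> 2 * real (2 * n + 1) * (\<Sum>d=1..2*n. p (int d) * (real d)\<^sup>2)"
proof -
  let ?h = "\<lambda>z. p z * (real_of_int z)\<^sup>2"
  have "(\<Sum>y\<in>box n. p (y - x) * (real_of_int x - real_of_int y)\<^sup>2) \<le> 2 * (\<Sum>d=1..2*n. p (int d) * (real d)\<^sup>2)"
    if x: "x \<in> box n" for x
  proof -
    have "(\<Sum>y\<in>box n. p (y - x) * (real_of_int x - real_of_int y)\<^sup>2) = (\<Sum>y\<in>box n. ?h (y - x))"
      by (intro sum.cong refl) (simp add: power2_commute)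
    also have "\<dots> = sum ?h ((\<lambda>y. y - x) ` box n)"
      by (subst sum.reindex) (auto simp: inj_on_def)
    also have "\<dots> \<le> sum ?h ({0} \<union> (int ` {1..2*n} \<union> (\<lambda>d. - int d) ` {1..2*n}))"
    proof (intro sum_mono2)
      have "z \<in> {0} \<union> (int ` {1..2*n} \<union> (\<lambda>d. - int d) ` {1..2*n})" if "\<bar>z\<bar> \<le> 2 * int n" for z
      proof (cases z "0 :: int" rule: linorder_cases)
        case less
        then have "z \<in> (\<lambda>d. - int d) ` {1..2*n}"
          using that by (intro image_eqI[of _ _ "nat (- z)"]) (auto simp: nat_le_iff)
        then show ?thesis by blast
      next
        case greater
        then have "z \<in> int ` {1..2*n}"
          using that by (intro image_eqI[of _ _ "nat z"]) (auto simp: nat_le_iff)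
        then show ?thesis by blast
      qed simp
      moreover have "\<bar>y - x\<bar> \<le> 2 * int n" if "y \<in> box n" for y
        using that x by (auto simp: box_def)
      ultimately show "(\<lambda>y. y - x) ` box n \<subseteq> {0} \<union> (int ` {1..2*n} \<union> (\<lambda>d. - int d) ` {1..2*n})"
        by blast
    qed (use nn in auto)
    also have "\<dots> = sum ?h (int ` {1..2*n}) + sum ?h ((\<lambda>d. - int d) ` {1..2*n})"
      by (subst sum.union_disjoint, auto)+
    also have "\<dots> = 2 * (\<Sum>d=1..2*n. p (int d) * (real d)\<^sup>2)"
      using assms(1) by (simp add: sum.reindex inj_on_def symmetric_rate_def)
    finally show ?thesis .
  qed
  then have "graph_energy (box n) (\<lambda>x y. p (y - x)) real_of_int
      \<le> (\<Sum>x\<in>box n. 2 * (\<Sum>d=1..2*n. p (int d) * (real d)\<^sup>2))"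
    unfolding graph_energy_def by (rule sum_mono)
  also have "\<dots> = 2 * real (2 * n + 1) * (\<Sum>d=1..2*n. p (int d) * (real d)\<^sup>2)"
    unfolding sum_constant card_box by (simp only: mult_ac)
  finally show ?thesis .
qed

lemma gap_ex_upper_bound:
  assumes "p \<in> DAN \<alpha>" "0 < p 1" "0 < \<alpha>" "\<alpha> < 2"
  obtains \<kappa> where "0 < \<kappa>"
    "\<And>n l. 1 \<le> n \<Longrightarrow> 0 < l \<Longrightarrow> l < 2 * n + 1 \<Longrightarrow> gap_ex p n l \<le> ereal (\<kappa> * real (2 * n + 1) powr (-\<alpha>))"
proof -
  have tr: "transition_rate p" and sym: "symmetric_rate p" using assms(1) by (simp_all add: DAN_def)
  have nn: "0 \<le> p z" for z using tr by (simp add: transition_rate_def)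
  obtain K where K: "0 < K" and moment: "\<And>M. (\<Sum>d=1..M. p (int d) * (real d)\<^sup>2) \<le> K * real M powr (2 - \<alpha>)"
    using DAN_second_moment_bound[OF assms(1,3,4)] by blast
  show ?thesis
  \<comment> \<open>With q = n (n+1) one has N^2 = 4 q + 1 <= 6 q, so the sum of squares q N / 3 is
    at least N^3 / 18.\<close>
  proof (rule that[of "18 * K"])
    show "0 < 18 * K" using K by simp
    fix n l :: nat assume n: "1 \<le> n" and l: "0 < l" "l < 2 * n + 1"
    define N where "N = real (2 * n + 1)"
    define S where "S = (\<Sum>x\<in>box n. (real_of_int x)\<^sup>2)"
    have N: "0 < N" unfolding N_def by simp
    have S: "N ^ 3 / 18 \<le> S"
    proof -
      define q where "q = real n * (real n + 1)"
      have "N\<^sup>2 = 4 * q + 1" unfolding N_def q_def by (simp add: power2_eq_square algebra_simps)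
      moreover have "1 * (1 + 1) \<le> q" unfolding q_def using n by (intro mult_mono) auto
      ultimately have "N\<^sup>2 * N \<le> 6 * q * N" using N by (intro mult_right_mono) auto
      moreover have "S = q * N / 3" unfolding S_def sum_box_squares q_def N_def by (simp add: add.commute)
      ultimately show ?thesis by (simp add: power2_eq_square power3_eq_cube)
    qed
    have S0: "0 < S" using N by (intro less_le_trans[OF _ S]) simp
    have "graph_energy (box n) (\<lambda>x y. p (y - x)) real_of_int \<le> 2 * N * (K * N powr (2 - \<alpha>))"
    proof -
      have "graph_energy (box n) (\<lambda>x y. p (y - x)) real_of_int
          \<le> 2 * N * (\<Sum>d=1..2*n. p (int d) * (real d)\<^sup>2)"
        unfolding N_def by (rule identity_energy_le[OF sym nn])
      also have "\<dots> \<le> 2 * N * (K * real (2 * n) powr (2 - \<alpha>))"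
        using N by (intro mult_left_mono moment) auto
      also have "\<dots> \<le> 2 * N * (K * N powr (2 - \<alpha>))"
        using N K assms(4) unfolding N_def by (intro mult_left_mono powr_mono2) auto
      finally show ?thesis .
    qed
    then have "graph_energy (box n) (\<lambda>x y. p (y - x)) real_of_int / (2 * S)
        \<le> 2 * N * (K * N powr (2 - \<alpha>)) / (2 * (N ^ 3 / 18))"
      using S N K by (intro frac_le) auto
    also have "\<dots> = 18 * K * N powr (-\<alpha>)"
      using N by (simp add: powr_diff powr_minus field_simps power2_eq_square power3_eq_cube)
    finally have le: "graph_energy (box n) (\<lambda>x y. p (y - x)) real_of_int / (2 * S) \<le> 18 * K * N powr (-\<alpha>)" .
    have "gap_ex p n l \<le> ereal (graph_energy (box n) (\<lambda>x y. p (y - x)) real_of_int / (2 * S))"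
      unfolding S_def
      by (rule gap_ex_le_rayleigh[OF tr sym assms(2) n l sum_box_id]) (use S0 in \<open>simp add: S_def\<close>)
    also have "\<dots> \<le> ereal (18 * K * N powr (-\<alpha>))" using le by simp
    finally show "gap_ex p n l \<le> ereal (18 * K * real (2 * n + 1) powr (-\<alpha>))" unfolding N_def .
  qed
qed

text \<open>For l = 0 and l = 2n+1 the level is a single configuration without non-zero eigenvalue,
  and the gap is infinite; the upper bound therefore concerns the levels strictly in
  between.\<close>

theorem theorem1p4:
  fixes p :: "int \<Rightarrow> real" and \<alpha> :: real
  assumes "transition_rate p" and "symmetric_rate p"
    and "p 1 > 0"
    and "0 < \<alpha>" and "\<alpha> < 2" and "p \<in> DAN \<alpha>"
  shows "\<exists>\<kappa>1 \<kappa>2 :: real. 0 < \<kappa>1 \<and> 0 < \<kappa>2 \<and>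
    (\<forall>n::nat. 1 \<le> n \<longrightarrow> (\<forall>l::nat. l \<le> 2 * n + 1 \<longrightarrow>
      ereal (\<kappa>1 * real (2 * n + 1) powr (- \<alpha>)) \<le> gap_ex p n l \<and>
      (l \<noteq> 0 \<and> l \<noteq> 2 * n + 1 \<longrightarrow>
        gap_ex p n l \<le> ereal (\<kappa>2 * real (2 * n + 1) powr (- \<alpha>)))))"
proof -
  obtain \<kappa>1 where "0 < \<kappa>1"
    "\<And>n l. 1 \<le> n \<Longrightarrow> l \<le> 2 * n + 1 \<Longrightarrow> ereal (\<kappa>1 * real (2 * n + 1) powr (-\<alpha>)) \<le> gap_ex p n l"
    using gap_ex_lower_bound[OF assms(6,3,4)] by blast
  moreover obtain \<kappa>2 where "0 < \<kappa>2"
    "\<And>n l. 1 \<le> n \<Longrightarrow> 0 < l \<Longrightarrow> l < 2 * n + 1 \<Longrightarrow> gap_ex p n l \<le> ereal (\<kappa>2 * real (2 * n + 1) powr (-\<alpha>))"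
    using gap_ex_upper_bound[OF assms(6,3,4,5)] by blast
  ultimately show ?thesis by (intro exI[of _ \<kappa>1] exI[of _ \<kappa>2]) (simp add: le_less)
qed

end
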